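(* Let $K\ge1$, let $D_X^K$ and $D_Y^K$ be two $K$-order dissimilarity networks on finite node sets $X$ and $Y$, and let $1\le k\le K$. Then for every $0\le k'<k$, $$ b^{k'}(D_X^K,D_Y^K)\le d^k_{\mathcal D}(D_X^K,D_Y^K),$$ where $b^{k'}$ is the bottleneck distance between the $k'$-th dimensional persistence diagrams of the induced filtrations $\mathcal L(D_X^K)$ and $\mathcal L(D_Y^K)$.
   Context: A $K$-order network on a finite set $X$ is a collection of functions $r_X^k:X^{k+1}\to[0,1]$, $0\le k\le K$, which are symmetric: $r_X^k(x_0,\dots,x_k)$ depends only on the set $\{x_0,\dots,x_k\}$ (not on order nor on repetitions). Write $x_{0:k}=(x_0,\dots,x_k)$. It is a dissimilarity network if for all $1\le k\le K$ and all $x_{0:k}$, $r_X^k(x_{0:k})\ge r_X^{k-1}(x_{0:k-1})$, with equality if and only if every element of $x_{0:k}$ already appears in $x_{0:k-1}$. A correspondence between $X$ and $Y$ is a set $C\subseteq X\times Y$ whose projections onto $X$ and onto $Y$ are surjective; $\mathcal C(X,Y)$ is the set of correspondences. For $0\le k\le K$ set $\Gamma^k_{X,Y}(C)=\max|r_X^k(x_{0:k})-r_Y^k(y_{0:k})|$ over all choices with $(x_i,y_i)\in C$ for $i=0,\dots,k$, and the $k$-order network distance $d^k_{\mathcal D}(D_X^K,D_Y^K)=\min_{C\in\mathcal C(X,Y)}\Gamma^k_{X,Y}(C)$. Induced filtration: for $\alpha\in[0,1]$, $L_\alpha$ is the simplicial complex of simplices $[x_{0:k}]$ (simplex on vertex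 set $\{x_0,\dots,x_k\}$), $0\le k\le K$, with $r_X^k(x_{0:k})\le\alpha$. The $j$-th dimensional persistence diagram is the multiset of points $(q_b,q_d)$, $q_b<q_d$, recording birth and death parameters of $j$-dimensional homology classes (over a fixed field) of $(L_\alpha)_\alpha$; classes never dying get death time $1$. Bottleneck distance: $c(\mathbf q,\tilde{\mathbf q})=\min\big[\max(|q_b-\tilde q_b|,|q_d-\tilde q_d|),\ \tfrac12\max(|q_d-q_b|,|\tilde q_d-\tilde q_b|)\big]$. For diagrams with point multisets $\mathcal Q,\tilde{\mathcal Q}$ of sizes $m\ge\tilde m$, augment $\tilde{\mathcal Q}$ by $m-\tilde m$ diagonal points $(t,t)$ to get $\tilde{\mathcal Q}_e$, and set $b^j=\min_\pi\max_{\mathbf q\in\mathcal Q}c(\mathbf q,\pi(\mathbf q))$ over bijections $\pi:\mathcal Q\to\tilde{\mathcal Q}_e$. *)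

theory Defs
  imports Complex_Main "HOL-Library.Multiset" "HOL-Library.Function_Algebras"
begin

text \<open>A K-order network on X is a family r k of functions on (k+1)-tuples of nodes;
tuples x_{0:k} are represented as lists of length k+1.  The value r k xs is only
relevant for lists of length k+1 with entries in X.\<close>

definition network :: "nat \<Rightarrow> 'a set \<Rightarrow> (nat \<Rightarrow> 'a list \<Rightarrow> real) \<Rightarrow> bool" where
  "network K X r \<longleftrightarrow>
     (\<forall>k\<le>K. \<forall>xs. length xs = Suc k \<and> set xs \<subseteq> X \<longrightarrow> 0 \<le> r k xs \<and> r k xs \<le> 1) \<and>
     (\<forall>k\<le>K. \<forall>xs ys. length xs = Suc k \<and> length ys = Suc k \<and> set xs \<subseteq> X \<and> set ys \<subseteq> X
         \<and> set xs = set ys \<longrightarrow> r k xs = r k ys)"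

definition dissim_network :: "nat \<Rightarrow> 'a set \<Rightarrow> (nat \<Rightarrow> 'a list \<Rightarrow> real) \<Rightarrow> bool" where
  "dissim_network K X r \<longleftrightarrow> network K X r \<and>
     (\<forall>k. 1 \<le> k \<and> k \<le> K \<longrightarrow> (\<forall>xs. length xs = Suc k \<and> set xs \<subseteq> X \<longrightarrow>
         r (k - 1) (butlast xs) \<le> r k xs \<and>
         (r k xs = r (k - 1) (butlast xs) \<longleftrightarrow> set xs = set (butlast xs))))"

definition correspondence :: "'a set \<Rightarrow> 'b set \<Rightarrow> ('a \<times> 'b) set \<Rightarrow> bool" where
  "correspondence X Y C \<longleftrightarrow> C \<subseteq> X \<times> Y \<and> fst ` C = X \<and> snd ` C = Y"

definition Gamma :: "(nat \<Rightarrow> 'a list \<Rightarrow> real) \<Rightarrow> (nat \<Rightarrow> 'b list \<Rightarrow> real) \<Rightarrow> nat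
                     \<Rightarrow> ('a \<times> 'b) set \<Rightarrow> real" where
  "Gamma rX rY k C = Max ((\<lambda>zs. \<bar>rX k (map fst zs) - rY k (map snd zs)\<bar>) `
                           {zs. length zs = Suc k \<and> set zs \<subseteq> C})"

definition net_dist :: "'a set \<Rightarrow> (nat \<Rightarrow> 'a list \<Rightarrow> real) \<Rightarrow> 'b set \<Rightarrow> (nat \<Rightarrow> 'b list \<Rightarrow> real)
                        \<Rightarrow> nat \<Rightarrow> real" where
  "net_dist X rX Y rY k = Min (Gamma rX rY k ` {C. correspondence X Y C})"

text \<open>Simplices are represented by their (finite, nonempty) vertex sets.\<close>
definition filt :: "nat \<Rightarrow> 'a set \<Rightarrow> (nat \<Rightarrow> 'a list \<Rightarrow> real) \<Rightarrow> real \<Rightarrow> 'a set set" where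
  "filt K X r \<alpha> = {\<sigma>. \<exists>k\<le>K. \<exists>xs. length xs = Suc k \<and> set xs \<subseteq> X \<and> set xs = \<sigma> \<and> r k xs \<le> \<alpha>}"

text \<open>The union of all L_beta with beta < alpha.\<close>
definition filt_lt :: "nat \<Rightarrow> 'a set \<Rightarrow> (nat \<Rightarrow> 'a list \<Rightarrow> real) \<Rightarrow> real \<Rightarrow> 'a set set" where
  "filt_lt K X r \<alpha> = {\<sigma>. \<exists>k\<le>K. \<exists>xs. length xs = Suc k \<and> set xs \<subseteq> X \<and> set xs = \<sigma> \<and> r k xs < \<alpha>}"

definition crit_vals :: "nat \<Rightarrow> 'a set \<Rightarrow> (nat \<Rightarrow> 'a list \<Rightarrow> real) \<Rightarrow> real set" where
  "crit_vals K X r = {r k xs | k xs. k \<le> K \<and> length xs = Suc k \<and> set xs \<subseteq> X}"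

text \<open>Chains: functions from vertex sets to the field, supported on j-simplices of L.
Orientation is induced by the linear order of the vertex type.\<close>
definition chains :: "'a set set \<Rightarrow> nat \<Rightarrow> ('a set \<Rightarrow> 'f::field) set" where
  "chains L j = {c. \<forall>\<sigma>. c \<sigma> \<noteq> 0 \<longrightarrow> \<sigma> \<in> L \<and> card \<sigma> = Suc j}"

text \<open>Boundary: the face tau of insert v tau (v \<notin> tau) gets sign (-1)^(position of v).
Nonempty faces only, so that the boundary of 0-chains is zero (non-reduced homology).\<close>
definition bd :: "'a::linorder set \<Rightarrow> ('a set \<Rightarrow> 'f::field) \<Rightarrow> 'a set \<Rightarrow> 'f" where
  "bd X c \<tau> = (if \<tau> = {} then 0 else
      (\<Sum>v\<in>X - \<tau>. (-1) ^ card {u\<in>\<tau>. u < v} * c (insert v \<tau>)))"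

definition cycles :: "'a::linorder set \<Rightarrow> 'a set set \<Rightarrow> nat \<Rightarrow> ('a set \<Rightarrow> 'f::field) set" where
  "cycles X L j = {c \<in> chains L j. bd X c = (\<lambda>_. 0)}"

definition boundaries :: "'a::linorder set \<Rightarrow> 'a set set \<Rightarrow> nat \<Rightarrow> ('a set \<Rightarrow> 'f::field) set" where
  "boundaries X L j = bd X ` chains L (Suc j)"

definition fdim :: "('a set \<Rightarrow> 'f::field) set \<Rightarrow> nat" where
  "fdim V = vector_space.dim (\<lambda>(a::'f) (v::'a set \<Rightarrow> 'f) x. a * v x) V"

text \<open>Persistent Betti number: rank of H_j(A) \<rightarrow> H_j(B) (coefficients in the field 'f)
induced by the inclusion A \<subseteq> B, namely dim((Z_j(A) + B_j(B)) / B_j(B)).\<close>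
definition pers_betti :: "'f::field itself \<Rightarrow> 'a::linorder set \<Rightarrow> nat \<Rightarrow> 'a set set \<Rightarrow> 'a set set \<Rightarrow> int" where
  "pers_betti F X j A B =
     int (fdim {(\<lambda>x. z x + b x) | z b. z \<in> (cycles X A j :: ('a set \<Rightarrow> 'f) set) \<and> b \<in> boundaries X B j})
     - int (fdim (boundaries X B j :: ('a set \<Rightarrow> 'f) set))"

text \<open>Multiplicity of the point (b,d), b<d, in the j-th persistence diagram of the
induced filtration (classes never dying get death time 1).  Standard rank formula:
mu(b,d) = beta^{b,d-} - beta^{b-,d-} - beta^{b,d} + beta^{b-,d}, where L_{a-} is the union
of L_t, t<a; for d = 1 the points dying at 1 and the never-dying ones are merged.\<close>
definition pd_mult :: "'f::field itself \<Rightarrow> nat \<Rightarrow> 'a::linorder set \<Rightarrow> (nat \<Rightarrow> 'a list \<Rightarrow> real)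
                       \<Rightarrow> nat \<Rightarrow> real \<Rightarrow> real \<Rightarrow> int" where
  "pd_mult F K X r j b d =
    (if d = 1 then
       pers_betti F X j (filt K X r b) (filt_lt K X r 1)
       - pers_betti F X j (filt_lt K X r b) (filt_lt K X r 1)
     else
       pers_betti F X j (filt K X r b) (filt_lt K X r d)
       - pers_betti F X j (filt_lt K X r b) (filt_lt K X r d)
       - pers_betti F X j (filt K X r b) (filt K X r d)
       + pers_betti F X j (filt_lt K X r b) (filt K X r d))"

text \<open>The j-th persistence diagram as a multiset of points (b,d) with b<d.  Births occur
only at critical values and deaths at critical values or at 1.\<close>
definition pers_diag :: "'f::field itself \<Rightarrow> nat \<Rightarrow> 'a::linorder set \<Rightarrow> (nat \<Rightarrow> 'a list \<Rightarrow> real)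
                         \<Rightarrow> nat \<Rightarrow> (real \<times> real) multiset" where
  "pers_diag F K X r j =
     (\<Sum>p\<in>{(b, d). b \<in> crit_vals K X r \<and> d \<in> insert 1 (crit_vals K X r) \<and> b < d}.
        replicate_mset (nat (pd_mult F K X r j (fst p) (snd p))) p)"

definition bcost :: "real \<times> real \<Rightarrow> real \<times> real \<Rightarrow> real" where
  "bcost q q' = min (max \<bar>fst q - fst q'\<bar> \<bar>snd q - snd q'\<bar>)
                    ((1/2) * max \<bar>snd q - fst q\<bar> \<bar>snd q' - fst q'\<bar>)"

text \<open>For size Q \<ge> size Q': Q' is augmented by size Q - size Q' diagonal points (t,t);
a bijection Q \<rightarrow> Q'_e is given by listing both multisets and pairing entries with equal index.
The maximum includes 0 so that two empty diagrams have distance 0.\<close>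
definition bottleneck_ge :: "(real \<times> real) multiset \<Rightarrow> (real \<times> real) multiset \<Rightarrow> real" where
  "bottleneck_ge Q Q' = Inf {Max (insert 0 ((\<lambda>i. bcost (qs ! i) (ps ! i)) ` {..<length qs})) | qs ps.
       mset qs = Q \<and> (\<exists>D. mset ps = Q' + D \<and> size D = size Q - size Q' \<and> (\<forall>p\<in>#D. fst p = snd p))}"

definition bottleneck :: "(real \<times> real) multiset \<Rightarrow> (real \<times> real) multiset \<Rightarrow> real" where
  "bottleneck Q Q' = (if size Q' \<le> size Q then bottleneck_ge Q Q' else bottleneck_ge Q' Q)"

end

(* A correspondence C between X and Y lets both networks be pulled back to one vertex set Z, a
   copy of the disjoint union of X and Y, with values that differ by at most Gamma(C) on every
   simplex with at most k + 1 vertices. Pulling back only duplicates vertices, and coning off a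
   duplicate by the original is a chain homotopy that respects the filtration, so persistent
   homology does not change. On Z the two filtration values f and g are joined by the segment
   f_t = (1 - t) f + t g. If one total order of the simplices sorts both f_s and f_t, their
   diagrams are images of a single multiset of pairs of simplices, whose multiplicities are
   nonnegative because dimension is submodular; hence they are matched within |s - t| Gamma(C).
   For t near s such an order exists, and bisection of [0, 1] together with composition of
   matchings gives the bound for f and g. *)

theory Submission
  imports Defs
begin

section \<open>Ranks of maps in persistent homology\<close>

text \<open>Orientation signs come from the linear orders of the vertex types, so each network needs
  an increasing embedding into the common vertex set. Taking \<open>C\<close> itself as that set
  fails: if \<open>C\<close> is the graph of an order-reversing bijection between sets of at least
  two points, no order of \<open>C\<close> suits both sides. Listing a copy of \<open>X\<close> and
  then a copy of \<open>Y\<close> does. Truncation is the second obstacle. A simplex of a network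
  has at most \<open>K + 1\<close> vertices, while duplication produces larger ones. On the cover
  only the image of a simplex is bounded, which leaves room for coning. Homology in dimension
  \<open>k'\<close> sees only simplices with \<open>k' + 1\<close> and \<open>k' + 2\<close>
  vertices, and \<open>k' < k\<close> makes these fit into tuples of length \<open>k + 1\<close>.
  When values tie, a sorting order may list a simplex before its faces, so its initial segments need
  not be complexes. The ranks and their inequalities are therefore established for arbitrary sets of
  simplices.\<close>

interpretation fs: vector_space "\<lambda>(a::'f::field) (v::'c \<Rightarrow> 'f) x. a * v x"
  by unfold_locales (auto simp: fun_eq_iff algebra_simps)

interpretation fsp: vector_space_pair
  "\<lambda>(a::'f::field) (v::'c \<Rightarrow> 'f) x. a * v x" "\<lambda>(a::'f::field) (v::'d \<Rightarrow> 'f) x. a * v x"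
  by unfold_locales

text \<open>A basis \<open>B\<close> of \<open>U \<inter> V\<close> is extended to a basis
  \<open>C\<close> of \<open>U\<close>, then by a set \<open>F\<close> of vectors of
  \<open>V\<close> to a basis of the sum; \<open>B \<union> F\<close> is a basis of
  \<open>V\<close>. The finite set \<open>T\<close> keeps all these bases finite, so that their
  cardinalities can be added.\<close>

lemma (in vector_space) dim_sum_Int_finite:
  assumes U: "subspace U" and V: "subspace V" and T: "finite T" "U \<subseteq> span T" "V \<subseteq> span T"
  shows "dim {x + y |x y. x \<in> U \<and> y \<in> V} + dim (U \<inter> V) = dim U + dim V"
proof -
  obtain B where B: "B \<subseteq> U \<inter> V" "independent B" "U \<inter> V \<subseteq> span B" "card B = dim (U \<inter> V)"
    using basis_exists by blast
  obtain C where C: "B \<subseteq> C" "C \<subseteq> U" "independent C" "U \<subseteq> span C"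
    using maximal_independent_subset_extend[of B U] B by blast
  obtain E where E: "C \<subseteq> E" "E \<subseteq> C \<union> V" "independent E" "C \<union> V \<subseteq> span E"
    using maximal_independent_subset_extend[of C "C \<union> V"] C by blast
  define F where "F = E - C"
  have finC: "finite C" using independent_span_bound[OF T(1) C(3)] C(2) T(2) by blast
  have finE: "finite E" using independent_span_bound[OF T(1) E(3)] E(2) C(2) T by blast
  have FV: "F \<subseteq> V" using E(2) F_def by blast
  have spanF: "span F \<subseteq> V" using span_minimal[OF FV V] .
  have spanC: "span C \<subseteq> U" using span_minimal[OF C(2) U] .
  have EF: "E = C \<union> F" using E(1) F_def by blast
  \<comment> \<open>The component of \<open>v\<close> in \<open>span C\<close> lies in
    \<open>U\<close> and, being \<open>v - f\<close>, also in \<open>V\<close>; so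
    \<open>span B\<close> already contains it.\<close>
  have VBF: "V \<subseteq> span (B \<union> F)"
  proof
    fix v assume v: "v \<in> V"
    then have "v \<in> span (C \<union> F)" using E(4) EF by blast
    then obtain c f where cf: "v = c + f" "c \<in> span C" "f \<in> span F"
      unfolding span_Un by blast
    then have "c = v - f" by simp
    then have "c \<in> V" using v cf(3) spanF V by (metis subsetD subspace_diff)
    then have "c \<in> span B" using cf(2) spanC B(3) by blast
    then show "v \<in> span (B \<union> F)" using cf unfolding span_Un by blast
  qed
  have indBF: "independent (B \<union> F)"
    by (rule independent_mono[OF E(3)]) (use C(1) EF in blast)
  have dV: "dim V = card (B \<union> F)"
    using basis_card_eq_dim[OF _ VBF indBF] B(1) FV by auto
  have dU: "dim U = card C" using basis_card_eq_dim[OF C(2) C(4) C(3)] by simp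
  have dS: "dim {x + y |x y. x \<in> U \<and> y \<in> V} = card E"
  proof (rule basis_card_eq_dim[symmetric])
    show "E \<subseteq> {x + y |x y. x \<in> U \<and> y \<in> V}"
    proof
      fix x assume "x \<in> E"
      then consider "x \<in> U" | "x \<in> V" using E(2) C(2) by blast
      then show "x \<in> {x + y |x y. x \<in> U \<and> y \<in> V}"
      proof cases
        case 1
        have "x = x + 0" by simp
        with 1 subspace_0[OF V] show ?thesis by blast
      next
        case 2
        have "x = 0 + x" by simp
        with 2 subspace_0[OF U] show ?thesis by blast
      qed
    qed
    have "U \<subseteq> span E" using C(4) span_mono[OF E(1)] by blast
    then show "{x + y |x y. x \<in> U \<and> y \<in> V} \<subseteq> span E" using E(4) by (auto intro!: span_add)
    show "independent E" by fact
  qed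
  have "card (B \<union> F) = card B + card F"
    by (rule card_Un_disjoint) (use finC finE C(1) F_def finite_subset in auto)
  moreover have "card E = card C + card F"
    unfolding EF by (rule card_Un_disjoint) (use finC finE F_def in auto)
  ultimately show ?thesis using dV dU dS B(4) by simp
qed

text \<open>\<open>dim\<close> is the cardinality of a basis, hence 0 for an infinite one; the
  finite spanning set of \<open>V\<close> excludes that.\<close>

lemma (in vector_space) dim_mono_finite:
  assumes "finite T" "V \<subseteq> span T" "U \<subseteq> V"
  shows "dim U \<le> dim V"
proof -
  obtain B where B: "B \<subseteq> U" "independent B" "U \<subseteq> span B" "card B = dim U"
    using basis_exists by blast
  obtain C where C: "B \<subseteq> C" "C \<subseteq> V" "independent C" "V \<subseteq> span C"
    using maximal_independent_subset_extend[OF subset_trans[OF B(1) assms(3)] B(2)] by metis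
  have "finite C" using independent_span_bound[OF assms(1) C(3)] C(2) assms(2) by blast
  then show ?thesis using B(4) basis_card_eq_dim[OF C(2) C(4) C(3)] card_mono[of C B] C(1) by simp
qed

lemma (in vector_space_pair) dim_inj_image:
  assumes f: "Vector_Spaces.linear s1 s2 f" and inj: "inj_on f S" and S: "vs1.subspace S"
  shows "vs2.dim (f ` S) = vs1.dim S"
proof -
  obtain B where B: "B \<subseteq> S" "vs1.independent B" "S \<subseteq> vs1.span B" "card B = vs1.dim S"
    using vs1.basis_exists by blast
  have SB: "vs1.span B = S" using vs1.span_minimal[OF B(1) S] B(3) by blast
  have "vs2.independent (f ` B)"
    using linear_independent_injective_image[OF f B(2)] inj SB by simp
  moreover have "f ` S \<subseteq> vs2.span (f ` B)"
    using linear_span_image[OF f, of B] SB by simp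
  moreover have "card (f ` B) = card B"
    by (rule card_image) (rule inj_on_subset[OF inj B(1)])
  ultimately show ?thesis
    using vs2.basis_card_eq_dim[of "f ` B" "f ` S"] B(4) image_mono[OF B(1), of f] by argo
qed

text \<open>The ambient space of all dimension counts: for finite \<open>S\<close> it is spanned by
  the indicator functions of the elements of \<open>S\<close>.\<close>

definition supp_in :: "'c set \<Rightarrow> ('c \<Rightarrow> 'f::zero) set" where
  "supp_in S = {c. \<forall>\<sigma>. c \<sigma> \<noteq> 0 \<longrightarrow> \<sigma> \<in> S}"

lemma supp_in_subset_span:
  fixes S :: "'c set"
  assumes "finite S"
  shows "(supp_in S :: ('c \<Rightarrow> 'f::field) set) \<subseteq> fs.span ((\<lambda>\<sigma> x. if x = \<sigma> then 1 else 0) ` S)"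
proof
  fix c :: "'c \<Rightarrow> 'f" assume c: "c \<in> supp_in S"
  have "c = (\<Sum>\<sigma>\<in>S. (\<lambda>x. c \<sigma> * (if x = \<sigma> then 1 else 0)))"
  proof
    fix x
    have "(\<Sum>\<sigma>\<in>S. (\<lambda>x. c \<sigma> * (if x = \<sigma> then 1 else 0))) x = (\<Sum>\<sigma>\<in>S. c \<sigma> * (if x = \<sigma> then 1 else 0))"
      using assms by (induction S) auto
    also have "\<dots> = (\<Sum>\<sigma>\<in>S. if x = \<sigma> then c \<sigma> else 0)" by (rule sum.cong) auto
    also have "\<dots> = c x" using assms c by (auto simp: supp_in_def)
    finally show "c x = (\<Sum>\<sigma>\<in>S. (\<lambda>x. c \<sigma> * (if x = \<sigma> then 1 else 0))) x" by simp
  qed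
  also have "\<dots> \<in> fs.span ((\<lambda>\<sigma> x. if x = \<sigma> then 1 else 0) ` S)"
    by (intro fs.span_sum fs.span_scale fs.span_base) auto
  finally show "c \<in> fs.span ((\<lambda>\<sigma> x. if x = \<sigma> then 1 else 0) ` S)" .
qed

lemma fdim_eq: "fdim V = fs.dim V"
  by (simp add: fdim_def)

lemma fdim_sum_Int:
  fixes U V :: "('a set \<Rightarrow> 'f::field) set"
  assumes "finite S" "fs.subspace U" "fs.subspace V" "U \<subseteq> supp_in S" "V \<subseteq> supp_in S"
  shows "fdim {\<lambda>x. u x + v x |u v. u \<in> U \<and> v \<in> V} + fdim (U \<inter> V) = fdim U + fdim V"
proof -
  have "{\<lambda>x. u x + v x |u v. u \<in> U \<and> v \<in> V} = {u + v |u v. u \<in> U \<and> v \<in> V}"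
    by (simp add: plus_fun_def)
  then show ?thesis
    unfolding fdim_eq
    using fs.dim_sum_Int_finite[OF assms(2,3), of "(\<lambda>\<sigma> x. if x = \<sigma> then 1 else 0) ` S"]
      supp_in_subset_span[OF assms(1), where 'f = 'f] assms(1,4,5) by auto
qed

lemma fdim_mono:
  fixes U V :: "('a set \<Rightarrow> 'f::field) set"
  assumes "finite S" "V \<subseteq> supp_in S" "U \<subseteq> V"
  shows "fdim U \<le> fdim V"
  unfolding fdim_eq
  using fs.dim_mono_finite[of "(\<lambda>\<sigma> x. if x = \<sigma> then 1 else 0) ` S" V U]
      supp_in_subset_span[OF assms(1), where 'f = 'f] assms by auto

lemma subspace_fun_iff:
  fixes V :: "('c \<Rightarrow> 'f::field) set"
  shows "fs.subspace V \<longleftrightarrow> (\<lambda>_. 0) \<in> V \<and> (\<forall>x\<in>V. \<forall>y\<in>V. (\<lambda>t. x t + y t) \<in> V) \<and> (\<forall>c. \<forall>x\<in>V. (\<lambda>t. c * x t) \<in> V)"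
  by (simp add: fs.subspace_def plus_fun_def zero_fun_def)

text \<open>The sum of \<open>U\<close> and \<open>V\<close> stays inside \<open>W\<close>, so the
  dimension formula gives the bound. Both inequalities between ranks below are instances.\<close>

lemma fdim_submodular:
  fixes U V W :: "('a set \<Rightarrow> 'f::field) set"
  assumes S: "finite S" "fs.subspace U" "fs.subspace V" "fs.subspace W" "W \<subseteq> supp_in S"
    and "U \<subseteq> W" "V \<subseteq> W"
  shows "fdim U + fdim V \<le> fdim W + fdim (U \<inter> V)"
proof -
  have "{\<lambda>x. u x + v x |u v. u \<in> U \<and> v \<in> V} \<subseteq> W"
    using S(4) assms(6,7) unfolding subspace_fun_iff by blast
  from fdim_mono[OF S(1) S(5) this] fdim_sum_Int[OF S(1-3)] subset_trans[OF assms(6) S(5)]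
    subset_trans[OF assms(7) S(5)] show ?thesis by simp
qed

section \<open>Chains, cycles and boundaries as subspaces\<close>

lemma subspace_chains: "fs.subspace (chains L j)"
proof -
  have "x \<sigma> \<noteq> 0 \<or> y \<sigma> \<noteq> 0" if "x \<sigma> + y \<sigma> \<noteq> 0" for x y :: "'b set \<Rightarrow> 'a" and \<sigma>
    using that by auto
  then show ?thesis unfolding subspace_fun_iff chains_def by fastforce
qed

lemma linear_bd: "Vector_Spaces.linear (\<lambda>(a::'f::field) v x. a * v x) (\<lambda>(a::'f) v x. a * v x) (bd X)"
  unfolding Vector_Spaces.linear_iff
  by (intro conjI fs.vector_space_axioms) (auto simp: bd_def fun_eq_iff algebra_simps sum.distrib sum_distrib_left)

lemma bd_add: "bd X (\<lambda>s. c s + d s) = (\<lambda>s. bd X c s + bd X d s)"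
  using fsp.linear_add[OF linear_bd, of X c d] by (simp add: plus_fun_def)

lemma bd_diff: "bd X (\<lambda>s. c s - d s) = (\<lambda>s. bd X c s - bd X d s)"
  using fsp.linear_diff[OF linear_bd, of X c d] by (simp add: fun_diff_def)

lemma bd_scale: "bd X (\<lambda>s. k * c s) = (\<lambda>s. k * bd X c s)"
  using fsp.linear_scale[OF linear_bd, of X k c] by simp

lemma bd_zero: "bd X (\<lambda>s. 0) = (\<lambda>s. 0)"
  by (auto simp: bd_def fun_eq_iff)

lemma subspace_cycles: "fs.subspace (cycles X L j :: ('a::linorder set \<Rightarrow> 'f::field) set)"
proof -
  have "fs.subspace (chains L j :: ('a set \<Rightarrow> 'f) set)" by (rule subspace_chains)
  then show ?thesis unfolding cycles_def subspace_fun_iff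
    by (simp add: bd_add bd_scale bd_zero)
qed

lemma subspace_boundaries: "fs.subspace (boundaries X L j :: ('a::linorder set \<Rightarrow> 'f::field) set)"
  unfolding boundaries_def by (rule fsp.linear_subspace_image[OF linear_bd subspace_chains])

lemma chains_mono: "A \<subseteq> B \<Longrightarrow> chains A j \<subseteq> chains B j"
  by (auto simp: chains_def)

lemma cycles_mono: "A \<subseteq> B \<Longrightarrow> cycles X A j \<subseteq> cycles X B j"
  by (auto simp: cycles_def chains_def)

lemma boundaries_mono: "A \<subseteq> B \<Longrightarrow> boundaries X A j \<subseteq> boundaries X B j"
  unfolding boundaries_def by (rule image_mono) (rule chains_mono)

lemma cycles_supp: "A \<subseteq> Pow X \<Longrightarrow> (cycles X A j :: ('a::linorder set \<Rightarrow> 'f::field) set) \<subseteq> supp_in (Pow X)"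
  by (auto simp: cycles_def chains_def supp_in_def)

lemma bd_supp:
  assumes "c \<in> supp_in (Pow X)"
  shows "bd X c \<in> supp_in (Pow X)"
  unfolding supp_in_def
proof (intro CollectI allI impI)
  fix \<tau> assume "bd X c \<tau> \<noteq> 0"
  then have "(\<Sum>v\<in>X - \<tau>. (-1) ^ card {u\<in>\<tau>. u < v} * c (insert v \<tau>)) \<noteq> 0"
    by (simp add: bd_def split: if_splits)
  then obtain v where "(-1) ^ card {u\<in>\<tau>. u < v} * c (insert v \<tau>) \<noteq> 0"
    by (rule sum.not_neutral_contains_not_neutral)
  then have "c (insert v \<tau>) \<noteq> 0" by simp
  then show "\<tau> \<in> Pow X" using assms by (auto simp: supp_in_def)
qed

lemma chains_supp: "A \<subseteq> Pow X \<Longrightarrow> chains A j \<subseteq> supp_in (Pow X)"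
  by (auto simp: chains_def supp_in_def)

lemma boundaries_supp:
  assumes "A \<subseteq> Pow X"
  shows "(boundaries X A j :: ('a::linorder set \<Rightarrow> 'f::field) set) \<subseteq> supp_in (Pow X)"
  unfolding boundaries_def
  by (rule image_subsetI, rule bd_supp, rule subsetD[OF chains_supp[OF assms]])

text \<open>Expanding the dimension of the sum cancels the dimension of the boundaries. The right
  side is meaningful for arbitrary families \<open>A\<close> and \<open>B\<close> of vertex sets,
  and the stability argument evaluates it at such families.\<close>

lemma pers_betti_eq:
  fixes F :: "'f::field itself"
  assumes "finite X" "A \<subseteq> Pow X" "B \<subseteq> Pow X"
  shows "pers_betti F X j A B =
    int (fdim (cycles X A j :: ('a::linorder set \<Rightarrow> 'f) set))
    - int (fdim (cycles X A j \<inter> boundaries X B j :: ('a set \<Rightarrow> 'f) set))"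
  using fdim_sum_Int[of "Pow X" "cycles X A j :: ('a set \<Rightarrow> 'f) set" "boundaries X B j"]
    assms(1) cycles_supp[OF assms(2), of j, where 'f = 'f] boundaries_supp[OF assms(3), of j, where 'f = 'f]
    subspace_cycles[of X A j, where 'f = 'f] subspace_boundaries[of X B j, where 'f = 'f]
  unfolding pers_betti_def by simp

text \<open>Once the cycle dimensions cancel, this is \<open>fdim_submodular\<close> for
  \<open>?Z \<inter> ?B\<close> and \<open>?Z' \<inter> ?B'\<close> inside
  \<open>?Z \<inter> ?B'\<close>; the intersection of the two is
  \<open>?Z' \<inter> ?B\<close>.\<close>

lemma pers_betti_submodular:
  fixes F :: "'f::field itself"
  assumes X: "finite X" "A \<subseteq> Pow X" "B' \<subseteq> Pow X" and "A' \<subseteq> A" "B \<subseteq> B'"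
  shows "pers_betti F X j A' B + pers_betti F X j A B' \<le> pers_betti F X j A B + pers_betti F X j A' B'"
proof -
  let ?Z = "cycles X A j :: ('a set \<Rightarrow> 'f) set" and ?Z' = "cycles X A' j :: ('a set \<Rightarrow> 'f) set"
  let ?B = "boundaries X B j :: ('a set \<Rightarrow> 'f) set" and ?B' = "boundaries X B' j :: ('a set \<Rightarrow> 'f) set"
  have sub: "?Z' \<subseteq> ?Z" "?B \<subseteq> ?B'" by (rule cycles_mono boundaries_mono, rule assms)+
  have "fdim (?Z \<inter> ?B) + fdim (?Z' \<inter> ?B') \<le> fdim (?Z \<inter> ?B') + fdim ((?Z \<inter> ?B) \<inter> (?Z' \<inter> ?B'))"
    by (rule fdim_submodular[of "Pow X"])
      (use X cycles_supp[OF X(2), of j, where 'f = 'f] sub in \<open>auto intro!: fs.subspace_inter subspace_cycles subspace_boundaries\<close>)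
  moreover have "(?Z \<inter> ?B) \<inter> (?Z' \<inter> ?B') = ?Z' \<inter> ?B" using sub by blast
  moreover have "A' \<subseteq> Pow X" "B \<subseteq> Pow X" using assms by auto
  ultimately show ?thesis using X
    by (simp add: pers_betti_eq)
qed

text \<open>\<open>fdim_submodular\<close> for \<open>?Z'\<close> and \<open>?Z \<inter> ?B\<close>
  inside \<open>?Z\<close>. It takes the place of \<open>pers_betti_submodular\<close> when
  everything dies at the later stage.\<close>

lemma pers_betti_mono:
  fixes F :: "'f::field itself"
  assumes X: "finite X" "A \<subseteq> Pow X" "B \<subseteq> Pow X" and "A' \<subseteq> A"
  shows "pers_betti F X j A' B \<le> pers_betti F X j A B"
proof -
  let ?Z = "cycles X A j :: ('a set \<Rightarrow> 'f) set" and ?Z' = "cycles X A' j :: ('a set \<Rightarrow> 'f) set"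
  let ?B = "boundaries X B j :: ('a set \<Rightarrow> 'f) set"
  have sub: "?Z' \<subseteq> ?Z" by (rule cycles_mono) (rule assms)
  have "fdim ?Z' + fdim (?Z \<inter> ?B) \<le> fdim ?Z + fdim (?Z' \<inter> (?Z \<inter> ?B))"
    by (rule fdim_submodular[of "Pow X"])
      (use X cycles_supp[OF X(2), of j, where 'f = 'f] sub in \<open>auto intro!: fs.subspace_inter subspace_cycles subspace_boundaries\<close>)
  moreover have "?Z' \<inter> (?Z \<inter> ?B) = ?Z' \<inter> ?B" using sub by blast
  moreover have "A' \<subseteq> Pow X" using assms by auto
  ultimately show ?thesis using X
    by (simp add: pers_betti_eq)
qed

section \<open>Removing a duplicate vertex\<close>

text \<open>For \<open>v \<notin> \<tau>\<close>, the incidence sign of the face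
  \<open>\<tau>\<close> in \<open>insert v \<tau>\<close>, as in \<open>bd\<close>.\<close>

definition vsgn :: "'a::linorder \<Rightarrow> 'a set \<Rightarrow> 'f::field" where
  "vsgn v \<tau> = (-1) ^ card {u\<in>\<tau>. u < v}"

lemma vsgn_square [simp]: "vsgn v \<tau> * vsgn v \<tau> = 1"
  by (simp add: vsgn_def power_mult_distrib[symmetric])

lemma vsgn_square' [simp]: "vsgn v \<tau> * (vsgn v \<tau> * c) = c"
  by (simp add: mult.assoc[symmetric])

lemma vsgn_insert:
  assumes "finite \<tau>" "v \<notin> \<tau>"
  shows "vsgn w (insert v \<tau>) = (if v < w then - vsgn w \<tau> else vsgn w \<tau>)"
proof -
  have "{u \<in> insert v \<tau>. u < w} = (if v < w then insert v {u\<in>\<tau>. u < w} else {u\<in>\<tau>. u < w})"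
    by auto
  then show ?thesis using assms by (simp add: vsgn_def)
qed

lemma vsgn_swap:
  assumes "finite \<tau>" "v \<notin> \<tau>" "w \<notin> \<tau>" "v \<noteq> w"
  shows "vsgn v \<tau> * vsgn w (insert v \<tau>) = - (vsgn w \<tau> * vsgn v (insert w \<tau>))"
  using assms by (auto simp: vsgn_insert)

lemma bd_vsgn: "bd X c \<tau> = (if \<tau> = {} then 0 else \<Sum>v\<in>X - \<tau>. vsgn v \<tau> * c (insert v \<tau>))"
  by (simp add: bd_def vsgn_def)

text \<open>Exchanging the two summation indices would only give \<open>s = - s\<close>, which
  proves nothing in characteristic 2. The induction instead cancels the terms in pairs.\<close>

lemma sum_antisym_eq_0:
  fixes T :: "'a::linorder \<Rightarrow> 'a \<Rightarrow> 'f::ab_group_add"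
  assumes "finite S" and T: "\<And>v w. v \<in> S \<Longrightarrow> w \<in> S \<Longrightarrow> v \<noteq> w \<Longrightarrow> T v w = - T w v"
  shows "(\<Sum>v\<in>S. \<Sum>w\<in>S - {v}. T v w) = 0"
  using assms
proof (induction S rule: finite_induct)
  case (insert x S)
  have "(\<Sum>v\<in>insert x S. \<Sum>w\<in>insert x S - {v}. T v w)
     = (\<Sum>w\<in>S. T x w) + (\<Sum>v\<in>S. \<Sum>w\<in>insert x S - {v}. T v w)"
    using insert.hyps by simp
  also have "(\<Sum>v\<in>S. \<Sum>w\<in>insert x S - {v}. T v w) = (\<Sum>v\<in>S. T v x + (\<Sum>w\<in>S - {v}. T v w))"
  proof (rule sum.cong)
    fix v assume v: "v \<in> S"
    then have "insert x S - {v} = insert x (S - {v})" using insert.hyps by auto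
    then show "(\<Sum>w\<in>insert x S - {v}. T v w) = T v x + (\<Sum>w\<in>S - {v}. T v w)"
      using insert.hyps by simp
  qed simp
  also have "\<dots> = (\<Sum>v\<in>S. T v x)"
  proof -
    have "(\<Sum>v\<in>S. \<Sum>w\<in>S - {v}. T v w) = 0"
      by (rule insert.IH) (rule insert.prems, simp_all)
    then show ?thesis by (simp add: sum.distrib)
  qed
  also have "\<dots> = (\<Sum>v\<in>S. - T x v)"
  proof (rule sum.cong)
    fix v assume "v \<in> S"
    then show "T v x = - T x v" using insert.hyps by (intro insert.prems) auto
  qed simp
  finally show ?case by (simp add: sum_negf)
qed simp

lemma bd_bd:
  assumes X: "finite X" and c: "c \<in> supp_in (Pow X)"
  shows "bd X (bd X c) = (\<lambda>_. 0)"
proof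
  fix \<tau>
  show "bd X (bd X c) \<tau> = 0"
  proof (cases "\<tau> \<noteq> {} \<and> \<tau> \<subseteq> X")
    case False
    have "bd X (bd X c) \<in> supp_in (Pow X)" by (intro bd_supp c)
    then have "\<not> \<tau> \<subseteq> X \<Longrightarrow> ?thesis" unfolding supp_in_def by blast
    moreover have "\<tau> = {} \<Longrightarrow> ?thesis" by (simp add: bd_def)
    ultimately show ?thesis using False by blast
  next
    case True
    then have fin: "finite \<tau>" using X finite_subset by blast
    have "bd X (bd X c) \<tau> = (\<Sum>v\<in>X - \<tau>. \<Sum>w\<in>(X - \<tau>) - {v}.
        vsgn v \<tau> * vsgn w (insert v \<tau>) * c (insert w (insert v \<tau>)))"
      using True by (simp add: bd_vsgn sum_distrib_left mult.assoc Diff_insert[symmetric] cong: sum.cong)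
    also have "\<dots> = 0"
    proof (rule sum_antisym_eq_0)
      fix v w assume "v \<in> X - \<tau>" "w \<in> X - \<tau>" "v \<noteq> w"
      then have "vsgn v \<tau> * vsgn w (insert v \<tau>) = - (vsgn w \<tau> * vsgn v (insert w \<tau>) :: 'b)"
        using vsgn_swap[OF fin] by blast
      then show "vsgn v \<tau> * vsgn w (insert v \<tau>) * c (insert w (insert v \<tau>)) =
          - (vsgn w \<tau> * vsgn v (insert w \<tau>) * c (insert v (insert w \<tau>)))"
        by (simp add: insert_commute)
    qed (use X in simp)
    finally show ?thesis .
  qed
qed

text \<open>Coning off by \<open>v\<close> the simplices that contain the duplicate \<open>v'\<close>: a chain homotopy from the
  identity to the map that replaces \<open>v'\<close> by \<open>v\<close>.\<close>
definition cone :: "'a::linorder \<Rightarrow> 'a \<Rightarrow> ('a set \<Rightarrow> 'f::field) \<Rightarrow> 'a set \<Rightarrow> 'f" where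
  "cone v v' c \<sigma> = (if v \<in> \<sigma> \<and> v' \<in> \<sigma> then vsgn v (\<sigma> - {v}) * c (\<sigma> - {v}) else 0)"

text \<open>Defined through the homotopy instead of by substitution in simplices: commuting with the
  boundary then follows from \<open>bd_bd\<close>, and the sign computation is confined to
  \<open>push_eq_0\<close>.\<close>

definition push :: "'a::linorder set \<Rightarrow> 'a \<Rightarrow> 'a \<Rightarrow> ('a set \<Rightarrow> 'f::field) \<Rightarrow> 'a set \<Rightarrow> 'f" where
  "push X v v' c = (\<lambda>\<sigma>. c \<sigma> - bd X (cone v v' c) \<sigma> - cone v v' (bd X c) \<sigma>)"

lemma cone_zero [simp]: "cone v v' (\<lambda>_. 0) = (\<lambda>_. 0)"
  by (auto simp: cone_def)

text \<open>If \<open>v \<notin> \<sigma>\<close>, only the insertion of \<open>v\<close> survives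
  in the boundary of the cone, and it yields \<open>c \<sigma>\<close>. If
  \<open>v \<in> \<sigma>\<close>, the term of \<open>bd X c (\<sigma> - {v})\<close> that puts
  \<open>v\<close> back yields \<open>c \<sigma>\<close>, and the remaining terms cancel against the
  boundary of the cone.\<close>

lemma push_eq_0:
  assumes X: "finite X" "v \<in> X" "v \<noteq> v'" and \<sigma>: "\<sigma> \<subseteq> X" "v' \<in> \<sigma>"
  shows "push X v v' c \<sigma> = 0"
proof (cases "v \<in> \<sigma>")
  case False
  have "bd X (cone v v' c) \<sigma> = (\<Sum>u\<in>X - \<sigma>. if u = v then c \<sigma> else 0)"
  proof -
    have "vsgn u \<sigma> * cone v v' c (insert u \<sigma>) = (if u = v then c \<sigma> else 0)" if "u \<in> X - \<sigma>" for u
      using that False \<sigma> by (cases "u = v") (auto simp: cone_def)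
    then show ?thesis using \<sigma> by (auto simp: bd_vsgn)
  qed
  also have "\<dots> = c \<sigma>" using X False by simp
  finally show ?thesis using False by (simp add: push_def cone_def)
next
  case True
  define \<tau> where "\<tau> = \<sigma> - {v}"
  have \<tau>: "finite \<tau>" "v \<notin> \<tau>" "v' \<in> \<tau>" "\<tau> \<noteq> {}" "\<sigma> = insert v \<tau>"
    using True X \<sigma> finite_subset[OF \<sigma>(1)] by (auto simp: \<tau>_def)
  have X\<tau>: "X - \<tau> = insert v (X - \<sigma>)" using \<tau>(2,5) X(2) by auto
  have fin: "finite (X - \<sigma>)" "v \<notin> X - \<sigma>" using X True by auto
  have "cone v v' (bd X c) \<sigma> = vsgn v \<tau> * bd X c \<tau>"
    using True \<sigma>(2) by (simp add: cone_def \<tau>_def)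
  also have "bd X c \<tau> = vsgn v \<tau> * c \<sigma> + (\<Sum>u\<in>X - \<sigma>. vsgn u \<tau> * c (insert u \<tau>))"
    unfolding bd_vsgn X\<tau> sum.insert[OF fin] \<tau>(5)[symmetric] using \<tau>(4) by simp
  finally have 1: "cone v v' (bd X c) \<sigma>
      = c \<sigma> + (\<Sum>u\<in>X - \<sigma>. vsgn v \<tau> * (vsgn u \<tau> * c (insert u \<tau>)))"
    by (simp add: distrib_left sum_distrib_left)
  \<comment> \<open>Here \<open>u\<close> and \<open>v\<close> are inserted into
    \<open>\<tau>\<close> in the opposite order to the sum in the preceding identity, whence the
    minus sign.\<close>
  have 2: "bd X (cone v v' c) \<sigma> = (\<Sum>u\<in>X - \<sigma>. - (vsgn v \<tau> * (vsgn u \<tau> * c (insert u \<tau>))))"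
  proof -
    have "vsgn u \<sigma> * cone v v' c (insert u \<sigma>) = - (vsgn v \<tau> * (vsgn u \<tau> * c (insert u \<tau>)))"
      if "u \<in> X - \<sigma>" for u
    proof -
      have u: "u \<notin> \<tau>" "u \<noteq> v" using that \<tau>(5) by auto
      have "insert u \<sigma> - {v} = insert u \<tau>" using \<tau>(2,5) u by auto
      then have "cone v v' c (insert u \<sigma>) = vsgn v (insert u \<tau>) * c (insert u \<tau>)"
        using True \<sigma>(2) by (simp add: cone_def)
      then show ?thesis
        unfolding \<tau>(5) vsgn_insert[OF \<tau>(1,2)] vsgn_insert[OF \<tau>(1) u(1)] using u by auto
    qed
    then show ?thesis using \<sigma> by (auto simp: bd_vsgn)
  qed
  show ?thesis unfolding push_def 1 2 by (simp add: sum_negf)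
qed

lemma push_id:
  assumes "v \<noteq> v'" and c: "\<And>\<sigma>. v' \<in> \<sigma> \<Longrightarrow> c \<sigma> = 0"
  shows "push X v v' c = c"
proof -
  have 1: "cone v v' c = (\<lambda>_. 0)" using assms by (auto simp: cone_def)
  have "bd X c \<sigma> = 0" if "v' \<in> \<sigma>" for \<sigma> using c that by (auto simp: bd_def)
  then have 2: "cone v v' (bd X c) = (\<lambda>_. 0)" using assms(1) by (auto simp: cone_def)
  show ?thesis by (simp add: push_def 1 2 bd_zero)
qed

lemma cone_supp:
  assumes "v \<in> X" "c \<in> supp_in (Pow X)"
  shows "cone v v' c \<in> supp_in (Pow X)"
  using assms by (auto simp: supp_in_def cone_def)

lemma bd_push:
  assumes "finite X" "v \<in> X" "c \<in> supp_in (Pow X)"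
  shows "bd X (push X v v' c) = push X v v' (bd X c)"
  using bd_bd[OF assms(1,3)] bd_bd[OF assms(1) cone_supp[OF assms(2,3), of v']]
  by (simp add: push_def bd_diff)

text \<open>The empty face is left out because homology is not reduced and the complexes consist of
  nonempty sets.\<close>

definition closed_complex :: "'a set set \<Rightarrow> bool" where
  "closed_complex A \<longleftrightarrow> (\<forall>\<sigma>\<in>A. \<forall>\<tau>. \<tau> \<subseteq> \<sigma> \<and> \<tau> \<noteq> {} \<longrightarrow> \<tau> \<in> A)"

lemma bd_chains:
  assumes A: "closed_complex A" and c: "c \<in> chains A (Suc j)" and j: "A \<subseteq> Pow X" "finite X"
  shows "bd X c \<in> chains A j"
  unfolding chains_def
proof (intro CollectI allI impI)
  fix \<tau> assume ne: "bd X c \<tau> \<noteq> 0"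
  then have "\<tau> \<noteq> {}" "(\<Sum>v\<in>X - \<tau>. (-1) ^ card {u\<in>\<tau>. u < v} * c (insert v \<tau>)) \<noteq> 0"
    by (auto simp: bd_def split: if_splits)
  moreover from this(2) obtain v where "v \<in> X - \<tau>" "(-1) ^ card {u\<in>\<tau>. u < v} * c (insert v \<tau>) \<noteq> 0"
    by (rule sum.not_neutral_contains_not_neutral)
  ultimately have "\<tau> \<noteq> {}" "v \<notin> \<tau>" "insert v \<tau> \<in> A" "card (insert v \<tau>) = Suc (Suc j)"
    using c by (auto simp: chains_def)
  moreover from this(3) have "\<tau> \<subseteq> X" using j(1) by blast
  then have "finite \<tau>" by (rule finite_subset[OF _ j(2)])
  ultimately show "\<tau> \<in> A \<and> card \<tau> = Suc j" using A unfolding closed_complex_def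
    by (metis Suc_inject card_insert_disjoint subset_insertI)
qed

lemma cone_chains:
  assumes A: "\<And>\<sigma>. \<sigma> \<in> A \<Longrightarrow> v' \<in> \<sigma> \<Longrightarrow> insert v \<sigma> \<in> A" and c: "c \<in> chains A j"
    and "A \<subseteq> Pow X" "finite X" "v \<noteq> v'"
  shows "cone v v' c \<in> chains A (Suc j)"
  unfolding chains_def
proof (intro CollectI allI impI)
  fix \<sigma> assume "cone v v' c \<sigma> \<noteq> 0"
  then have *: "v \<in> \<sigma>" "v' \<in> \<sigma>" "c (\<sigma> - {v}) \<noteq> 0" by (auto simp: cone_def split: if_splits)
  then have **: "\<sigma> - {v} \<in> A" "card (\<sigma> - {v}) = Suc j" using c by (auto simp: chains_def)
  then have "insert v (\<sigma> - {v}) \<in> A" using A[of "\<sigma> - {v}"] *(2) assms(5) by blast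
  then have "\<sigma> \<in> A" using *(1) by (simp add: insert_absorb)
  moreover have "\<sigma> \<subseteq> X" using \<open>\<sigma> \<in> A\<close> assms(3) by blast
  then have "finite \<sigma>" by (rule finite_subset[OF _ assms(4)])
  ultimately show "\<sigma> \<in> A \<and> card \<sigma> = Suc (Suc j)" using card_Suc_Diff1[OF _ *(1)] **(2) by simp
qed

lemma chains_diff: "c \<in> chains A j \<Longrightarrow> d \<in> chains A j \<Longrightarrow> (\<lambda>\<sigma>. c \<sigma> - d \<sigma>) \<in> chains A j"
  unfolding chains_def by (simp del: right_minus_eq) (metis diff_0_right)

lemma push_chains:
  assumes "finite X" "v \<in> X" "v \<noteq> v'" "A \<subseteq> Pow X" and P: "push X v v' c \<in> chains A j"
  shows "push X v v' c \<in> chains {\<sigma>\<in>A. v' \<notin> \<sigma>} j"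
  unfolding chains_def
proof (intro CollectI allI impI)
  fix \<sigma> assume *: "push X v v' c \<sigma> \<noteq> 0"
  then have "\<sigma> \<in> A" "card \<sigma> = Suc j" using P by (auto simp: chains_def)
  moreover have "v' \<notin> \<sigma>" using push_eq_0[OF assms(1-3)] * \<open>\<sigma> \<in> A\<close> assms(4) by blast
  ultimately show "\<sigma> \<in> {\<sigma>\<in>A. v' \<notin> \<sigma>} \<and> card \<sigma> = Suc j" by simp
qed

text \<open>\<open>push\<close> moves a cycle of \<open>A\<close> by a boundary of \<open>A\<close>,
  hence of \<open>B\<close>, to a cycle avoiding \<open>v'\<close>. So the sum of cycles and
  boundaries does not change when \<open>A\<close> shrinks, and neither does their intersection when
  \<open>B\<close> shrinks.\<close>

lemma pers_betti_remove_duplicate: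
  fixes F :: "'f::field itself"
  assumes X: "finite X" "A \<subseteq> Pow X" "B \<subseteq> Pow X" "A \<subseteq> B" "v \<in> X" "v \<noteq> v'"
    and cl: "closed_complex A" "closed_complex B"
    and dup: "\<And>\<sigma>. \<sigma> \<in> A \<Longrightarrow> v' \<in> \<sigma> \<Longrightarrow> insert v \<sigma> \<in> A" "\<And>\<sigma>. \<sigma> \<in> B \<Longrightarrow> v' \<in> \<sigma> \<Longrightarrow> insert v \<sigma> \<in> B"
  shows "pers_betti F X j A B = pers_betti F X j {\<sigma>\<in>A. v' \<notin> \<sigma>} {\<sigma>\<in>B. v' \<notin> \<sigma>}"
proof -
  define A0 where "A0 = {\<sigma>\<in>A. v' \<notin> \<sigma>}"
  define B0 where "B0 = {\<sigma>\<in>B. v' \<notin> \<sigma>}"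
  let ?Z = "cycles X A j :: ('a set \<Rightarrow> 'f) set" and ?Zs = "cycles X A0 j :: ('a set \<Rightarrow> 'f) set"
  let ?B = "boundaries X B j :: ('a set \<Rightarrow> 'f) set" and ?Bs = "boundaries X B0 j :: ('a set \<Rightarrow> 'f) set"
  have sub: "A0 \<subseteq> A" "B0 \<subseteq> B" "A0 \<subseteq> Pow X" "B0 \<subseteq> Pow X" using X by (auto simp: A0_def B0_def)
  have Z0Z: "?Zs \<subseteq> ?Z" by (rule cycles_mono[OF sub(1)])
  have B0B: "?Bs \<subseteq> ?B" by (rule boundaries_mono[OF sub(2)])
  have Zpush: "push X v v' z \<in> ?Zs \<and> (\<lambda>\<sigma>. z \<sigma> - push X v v' z \<sigma>) \<in> ?B" if z: "z \<in> ?Z" for z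
  proof -
    have zc: "z \<in> chains A j" "bd X z = (\<lambda>_. 0)" using z by (auto simp: cycles_def)
    have eq: "push X v v' z = (\<lambda>\<sigma>. z \<sigma> - bd X (cone v v' z) \<sigma>)"
      by (simp add: push_def zc(2))
    have h: "cone v v' z \<in> chains A (Suc j)"
      by (rule cone_chains[OF dup(1) zc(1) X(2,1,6)])
    then have "push X v v' z \<in> chains A j"
      unfolding eq by (intro chains_diff zc bd_chains[OF cl(1) _ X(2,1)])
    then have "push X v v' z \<in> chains A0 j"
      unfolding A0_def by (rule push_chains[OF X(1,5,6,2)])
    moreover have "z \<in> supp_in (Pow X)" using chains_supp[OF X(2)] zc(1) by blast
    then have "bd X (push X v v' z) = (\<lambda>_. 0)"
      using bd_push[OF X(1,5), of z v'] zc(2) by (simp add: push_def bd_zero)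
    moreover have "cone v v' z \<in> chains B (Suc j)" using h chains_mono[OF X(4)] by blast
    then have "(\<lambda>\<sigma>. z \<sigma> - push X v v' z \<sigma>) \<in> ?B" by (simp add: eq boundaries_def)
    ultimately show ?thesis by (simp add: cycles_def)
  qed
  \<comment> \<open>If \<open>w\<close> bounds a cycle \<open>z\<close> that avoids
    \<open>v'\<close>, then so does its push, because \<open>push\<close> fixes \<open>z\<close> and
    commutes with the boundary.\<close>
  have int: "?Zs \<inter> ?B = ?Zs \<inter> ?Bs"
  proof (rule antisym)
    show "?Zs \<inter> ?B \<subseteq> ?Zs \<inter> ?Bs"
    proof
      fix z assume "z \<in> ?Zs \<inter> ?B"
      then obtain w where z: "z \<in> ?Zs" and w: "w \<in> chains B (Suc j)" "z = bd X w"
        by (auto simp: boundaries_def)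
      have "\<And>\<sigma>. v' \<in> \<sigma> \<Longrightarrow> z \<sigma> = 0" using z by (auto simp: cycles_def chains_def A0_def)
      then have "push X v v' z = z" by (rule push_id[OF X(6)])
      moreover have "w \<in> supp_in (Pow X)" using chains_supp[OF X(3)] w(1) by blast
      ultimately have "bd X (push X v v' w) = z" using bd_push[OF X(1,5), of w v'] w(2) by simp
      moreover have "push X v v' w \<in> chains B (Suc j)"
        unfolding push_def
        by (intro chains_diff w bd_chains[OF cl(2) _ X(3,1)] cone_chains[OF dup(2) _ X(3,1,6)])
      then have "push X v v' w \<in> chains B0 (Suc j)"
        unfolding B0_def by (rule push_chains[OF X(1,5,6,3)])
      ultimately show "z \<in> ?Zs \<inter> ?Bs" using z by (auto simp: boundaries_def)
    qed
  show "?Zs \<inter> ?Bs \<subseteq> ?Zs \<inter> ?B" using B0B by (rule Int_mono[OF order_refl])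
  qed
  have sums: "{(\<lambda>x. z x + b x) | z b. z \<in> ?Z \<and> b \<in> ?B} = {(\<lambda>x. z x + b x) | z b. z \<in> ?Zs \<and> b \<in> ?B}"
    (is "?L = ?R")
  proof (rule antisym)
    show "?L \<subseteq> ?R"
    proof
      fix y assume "y \<in> ?L"
      then obtain z b where y: "y = (\<lambda>x. z x + b x)" "z \<in> ?Z" "b \<in> ?B" by auto
      have "(\<lambda>\<sigma>. (z \<sigma> - push X v v' z \<sigma>) + b \<sigma>) \<in> ?B"
        using fs.subspace_add[OF subspace_boundaries conjunct2[OF Zpush[OF y(2)]] y(3)]
        by (simp add: plus_fun_def)
      moreover have "y = (\<lambda>\<sigma>. push X v v' z \<sigma> + ((z \<sigma> - push X v v' z \<sigma>) + b \<sigma>))"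
        by (simp add: y)
      ultimately show "y \<in> ?R" using conjunct1[OF Zpush[OF y(2)]]
        by (intro CollectI exI conjI)
    qed
  show "?R \<subseteq> ?L" using subsetD[OF Z0Z] by blast
  qed
  \<comment> \<open>The defining formula involves \<open>A\<close> only through the sum, which
    settles the change of \<open>A\<close>; \<open>pers_betti_eq\<close> involves \<open>B\<close>
    only through the intersection, which settles the change of \<open>B\<close>.\<close>
  have "pers_betti F X j A B = pers_betti F X j A0 B"
    unfolding pers_betti_def sums ..
  also have "\<dots> = pers_betti F X j A0 B0"
    by (simp add: pers_betti_eq[OF X(1) sub(3)] X sub int)
  finally show ?thesis by (simp add: A0_def B0_def)
qed

section \<open>Pulling a filtration back along a map of vertices\<close>

text \<open>Transport of a chain forward along an embedding \<open>e\<close> with image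
  \<open>S\<close>, written by means of \<open>p\<close>, which inverts \<open>e\<close> on
  \<open>S\<close>.\<close>

definition relabel :: "'b set \<Rightarrow> ('b \<Rightarrow> 'a) \<Rightarrow> ('a set \<Rightarrow> 'f::field) \<Rightarrow> 'b set \<Rightarrow> 'f" where
  "relabel S p c \<tau> = (if \<tau> \<subseteq> S then c (p ` \<tau>) else 0)"

lemma linear_relabel:
  "Vector_Spaces.linear (\<lambda>(a::'f::field) v x. a * v x) (\<lambda>(a::'f) v x. a * v x) (relabel S p)"
  unfolding Vector_Spaces.linear_iff
  by (intro conjI fs.vector_space_axioms) (auto simp: relabel_def fun_eq_iff)

text \<open>\<open>e\<close> is an increasing section, so it preserves orientation signs. Vertices
  outside its image are duplicates, and \<open>p\<close> tells of which vertex each is a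
  copy.\<close>

locale relabelling =
  fixes X :: "'a::linorder set" and Z :: "'b::linorder set" and e :: "'a \<Rightarrow> 'b" and p :: "'b \<Rightarrow> 'a"
  assumes finX: "finite X" and finZ: "finite Z" and eX: "e ` X \<subseteq> Z"
    and pe: "\<And>x. x \<in> X \<Longrightarrow> p (e x) = x"
    and e_mono: "\<And>x y. x \<in> X \<Longrightarrow> y \<in> X \<Longrightarrow> x < y \<Longrightarrow> e x < e y"
begin

lemma e_less_iff: "x \<in> X \<Longrightarrow> y \<in> X \<Longrightarrow> e x < e y \<longleftrightarrow> x < y"
  using e_mono by (metis less_asym linorder_neqE)

lemma p_image: "\<sigma> \<subseteq> X \<Longrightarrow> p ` e ` \<sigma> = \<sigma>"
  using pe by (force simp: image_image)

lemma e_image: "\<tau> \<subseteq> e ` X \<Longrightarrow> e ` p ` \<tau> = \<tau>"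
  using pe by (force simp: image_image)

lemma p_image_subset: "\<tau> \<subseteq> e ` X \<Longrightarrow> p ` \<tau> \<subseteq> X"
  using pe by force

lemma inj_p: "inj_on p (e ` X)"
  using pe by (auto simp: inj_on_def)

lemma relabel_e: "\<sigma> \<subseteq> X \<Longrightarrow> relabel (e ` X) p c (e ` \<sigma>) = c \<sigma>"
  by (simp add: relabel_def image_mono p_image)

lemma inj_relabel: "inj_on (relabel (e ` X) p) (supp_in (Pow X))"
proof (rule inj_onI, rule ext)
  fix c d :: "'a set \<Rightarrow> 'c" and \<sigma>
  assume cd: "c \<in> supp_in (Pow X)" "d \<in> supp_in (Pow X)" "relabel (e ` X) p c = relabel (e ` X) p d"
  show "c \<sigma> = d \<sigma>"
  proof (cases "\<sigma> \<subseteq> X")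
    case True
    then show ?thesis using relabel_e[OF True, of c] relabel_e[OF True, of d] cd(3) by simp
  next
    case False
    then have "c \<sigma> = 0" "d \<sigma> = 0" using cd(1,2) by (auto simp: supp_in_def)
    then show ?thesis by simp
  qed
qed

lemma relabel_chains:
  assumes A: "A \<subseteq> Pow X"
  shows "relabel (e ` X) p ` chains A j = chains ((`) e ` A) j"
proof (intro antisym subsetI)
  fix c' assume "c' \<in> relabel (e ` X) p ` chains A j"
  then obtain c where c: "c \<in> chains A j" "c' = relabel (e ` X) p c" by auto
  show "c' \<in> chains ((`) e ` A) j"
    unfolding chains_def
  proof (intro CollectI allI impI)
    fix \<tau> assume "c' \<tau> \<noteq> 0"
    then have *: "\<tau> \<subseteq> e ` X" "c (p ` \<tau>) \<noteq> 0" by (auto simp: c(2) relabel_def split: if_splits)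
    then have "p ` \<tau> \<in> A" "card (p ` \<tau>) = Suc j" using c(1) by (auto simp: chains_def)
    moreover have "card (p ` \<tau>) = card \<tau>" by (rule card_image) (rule inj_on_subset[OF inj_p *(1)])
    moreover have "\<tau> = e ` (p ` \<tau>)" using e_image[OF *(1)] by simp
    ultimately show "\<tau> \<in> (`) e ` A \<and> card \<tau> = Suc j" by auto
  qed
next
  fix c' assume c': "c' \<in> chains ((`) e ` A) j"
  define c where "c = (\<lambda>\<sigma>. if \<sigma> \<subseteq> X then c' (e ` \<sigma>) else 0)"
  have inje: "inj_on e X" using pe by (metis inj_onI)
  have "c \<in> chains A j"
    unfolding chains_def
  proof (intro CollectI allI impI)
    fix \<sigma> assume "c \<sigma> \<noteq> 0"
    then have *: "\<sigma> \<subseteq> X" "c' (e ` \<sigma>) \<noteq> 0" by (auto simp: c_def split: if_splits)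
    then obtain \<rho> where \<rho>: "\<rho> \<in> A" "e ` \<sigma> = e ` \<rho>" "card (e ` \<sigma>) = Suc j"
      using c' by (auto simp: chains_def)
    then have "\<sigma> = \<rho>" using * A p_image[of \<sigma>] p_image[of \<rho>] by auto
    moreover have "card (e ` \<sigma>) = card \<sigma>" by (rule card_image) (rule inj_on_subset[OF inje *(1)])
    ultimately show "\<sigma> \<in> A \<and> card \<sigma> = Suc j" using \<rho> by simp
  qed
  moreover have "c' = relabel (e ` X) p c"
  proof
    fix \<tau>
    show "c' \<tau> = relabel (e ` X) p c \<tau>"
    proof (cases "\<tau> \<subseteq> e ` X")
      case True
      then show ?thesis by (simp add: relabel_def c_def p_image_subset e_image)
    next
      case False
      then have "\<tau> \<notin> (`) e ` A" using A by auto
      then show ?thesis using c' False by (auto simp: relabel_def chains_def)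
    qed
  qed
  ultimately show "c' \<in> relabel (e ` X) p ` chains A j" by blast
qed

text \<open>Inserting a vertex outside the image of \<open>e\<close> leaves the support of the
  relabelled chain; for the others, monotonicity of \<open>e\<close> preserves the number of smaller
  vertices and thus the sign.\<close>

lemma bd_relabel:
  assumes c: "c \<in> supp_in (Pow X)"
  shows "bd Z (relabel (e ` X) p c) = relabel (e ` X) p (bd X c)"
proof
  fix \<tau>
  consider "\<tau> = {}" | "\<not> \<tau> \<subseteq> e ` X" | "\<tau> \<noteq> {}" "\<tau> \<subseteq> e ` X" by blast
  then show "bd Z (relabel (e ` X) p c) \<tau> = relabel (e ` X) p (bd X c) \<tau>"
  proof cases
    case 3
    define \<sigma> where "\<sigma> = p ` \<tau>"
    have \<sigma>: "\<sigma> \<subseteq> X" "\<tau> = e ` \<sigma>" "\<sigma> \<noteq> {}"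
      using 3 e_image p_image_subset by (auto simp: \<sigma>_def)
    have inje: "inj_on e X" using pe by (metis inj_onI)
    have "bd Z (relabel (e ` X) p c) \<tau> = (\<Sum>z\<in>Z - \<tau>. vsgn z \<tau> * relabel (e ` X) p c (insert z \<tau>))"
      using 3 by (simp add: bd_vsgn)
    also have "\<dots> = (\<Sum>z\<in>e ` (X - \<sigma>). vsgn z \<tau> * relabel (e ` X) p c (insert z \<tau>))"
    proof (rule sum.mono_neutral_right)
      show "e ` (X - \<sigma>) \<subseteq> Z - \<tau>"
        using eX inj_on_image_set_diff[OF inje Diff_subset \<sigma>(1)] \<sigma>(2) by auto
      show "\<forall>z\<in>Z - \<tau> - e ` (X - \<sigma>). vsgn z \<tau> * relabel (e ` X) p c (insert z \<tau>) = 0"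
        using \<sigma>(2) by (auto simp: relabel_def)
    qed (use finZ in simp)
    also have "\<dots> = (\<Sum>x\<in>X - \<sigma>. vsgn (e x) \<tau> * relabel (e ` X) p c (insert (e x) \<tau>))"
      using sum.reindex[OF inj_on_subset[OF inje Diff_subset[of X \<sigma>]]] by (simp add: o_def)
    also have "\<dots> = (\<Sum>x\<in>X - \<sigma>. vsgn x \<sigma> * c (insert x \<sigma>))"
    proof (rule sum.cong)
      fix x assume x: "x \<in> X - \<sigma>"
      have "{u \<in> \<tau>. u < e x} = e ` {u \<in> \<sigma>. u < x}"
        using x \<sigma>(1) e_less_iff unfolding \<sigma>(2) by blast
      moreover have "card (e ` {u \<in> \<sigma>. u < x}) = card {u \<in> \<sigma>. u < x}"
        by (rule card_image) (rule inj_on_subset[OF inje], use \<sigma>(1) in auto)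
      moreover have "insert (e x) \<tau> = e ` insert x \<sigma>" using \<sigma>(2) by simp
      ultimately show "vsgn (e x) \<tau> * relabel (e ` X) p c (insert (e x) \<tau>) = vsgn x \<sigma> * c (insert x \<sigma>)"
        using relabel_e[of "insert x \<sigma>" c] x \<sigma>(1) by (simp add: vsgn_def)
    qed simp
    also have "\<dots> = relabel (e ` X) p (bd X c) \<tau>"
      using relabel_e[OF \<sigma>(1), of "bd X c"] \<sigma>(2,3) by (simp add: bd_vsgn)
    finally show ?thesis .
  qed (auto simp: bd_def relabel_def intro!: sum.neutral)
qed

lemma pers_betti_relabel:
  fixes F :: "'f::field itself"
  assumes A: "A \<subseteq> Pow X" and B: "B \<subseteq> Pow X"
  shows "pers_betti F Z j ((`) e ` A) ((`) e ` B) = pers_betti F X j A B"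
proof -
  let ?T = "relabel (e ` X) p :: ('a set \<Rightarrow> 'f) \<Rightarrow> 'b set \<Rightarrow> 'f"
  let ?Z = "cycles X A j :: ('a set \<Rightarrow> 'f) set" and ?B = "boundaries X B j :: ('a set \<Rightarrow> 'f) set"
  have suppA: "c \<in> supp_in (Pow X)" if "c \<in> chains A j" for c :: "'a set \<Rightarrow> 'f"
    using chains_supp[OF A] that by blast
  have suppB: "c \<in> supp_in (Pow X)" if "c \<in> chains B (Suc j)" for c :: "'a set \<Rightarrow> 'f"
    using chains_supp[OF B] that by blast
  have T0: "?T (\<lambda>_. 0) = (\<lambda>_. 0)" by (auto simp: relabel_def)
  have bd0: "bd Z (?T c) = (\<lambda>_. 0) \<longleftrightarrow> bd X c = (\<lambda>_. 0)" if "c \<in> chains A j" for c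
  proof -
    have "(\<lambda>_. 0) \<in> supp_in (Pow X)" by (simp add: supp_in_def)
    then show ?thesis
      using inj_onD[OF inj_relabel _ bd_supp[OF suppA[OF that]], of "\<lambda>_. 0"] T0
      by (auto simp: bd_relabel[OF suppA[OF that]])
  qed
  have Zeq: "cycles Z ((`) e ` A) j = ?T ` ?Z"
    unfolding cycles_def relabel_chains[OF A, symmetric] using bd0 by auto
  have "bd Z ` ?T ` chains B (Suc j) = ?T ` bd X ` chains B (Suc j)"
    unfolding image_image by (rule image_cong) (simp_all add: bd_relabel suppB)
  then have Beq: "boundaries Z ((`) e ` B) j = ?T ` ?B"
    unfolding boundaries_def relabel_chains[OF B, symmetric] .
  have ZS: "?Z \<subseteq> supp_in (Pow X)" and BS: "?B \<subseteq> supp_in (Pow X)"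
    by (rule cycles_supp[OF A] boundaries_supp[OF B])+
  have int: "cycles Z ((`) e ` A) j \<inter> boundaries Z ((`) e ` B) j = ?T ` (?Z \<inter> ?B)"
    unfolding Zeq Beq by (rule inj_on_image_Int[OF inj_relabel ZS BS, symmetric])
  have d1: "fdim (?T ` ?Z) = fdim ?Z"
    unfolding fdim_eq
    by (rule fsp.dim_inj_image[OF linear_relabel inj_on_subset[OF inj_relabel ZS] subspace_cycles])
  have ZBS: "?Z \<inter> ?B \<subseteq> supp_in (Pow X)" using ZS by blast
  have d2: "fdim (?T ` (?Z \<inter> ?B)) = fdim (?Z \<inter> ?B)"
    unfolding fdim_eq
    by (rule fsp.dim_inj_image[OF linear_relabel inj_on_subset[OF inj_relabel ZBS]
          fs.subspace_inter[OF subspace_cycles subspace_boundaries]])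
  have "(`) e ` A \<subseteq> Pow Z" "(`) e ` B \<subseteq> Pow Z" using A B eX by blast+
  then show ?thesis
    unfolding pers_betti_eq[OF finX A B]
    by (simp only: pers_betti_eq[OF finZ] int d2) (simp add: Zeq d1)
qed

end

text \<open>Only the image of \<open>\<sigma>\<close> has to be a simplex of \<open>A\<close>; the
  size of \<open>\<sigma>\<close> is unrestricted. Hence adding a vertex with the same image as one
  already present never leaves the family, even if \<open>A\<close> is truncated.\<close>

definition pull :: "'b set \<Rightarrow> ('b \<Rightarrow> 'a) \<Rightarrow> 'a set set \<Rightarrow> 'b set set" where
  "pull W p A = {\<sigma>. \<sigma> \<subseteq> W \<and> \<sigma> \<noteq> {} \<and> p ` \<sigma> \<in> A}"

lemma (in relabelling) pull_relabel:
  assumes "A \<subseteq> Pow X" "{} \<notin> A"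
  shows "pull (e ` X) p A = (`) e ` A"
proof (intro antisym subsetI)
  fix \<tau> assume "\<tau> \<in> pull (e ` X) p A"
  then have "p ` \<tau> \<in> A" "e ` p ` \<tau> = \<tau>" using e_image by (auto simp: pull_def)
  then show "\<tau> \<in> (`) e ` A" by (metis imageI)
next
  fix \<tau> assume "\<tau> \<in> (`) e ` A"
  then obtain \<sigma> where "\<sigma> \<in> A" "\<tau> = e ` \<sigma>" by blast
  then show "\<tau> \<in> pull (e ` X) p A" using assms p_image[of \<sigma>] by (auto simp: pull_def)
qed

text \<open>Starting from the image of \<open>e\<close>, where the pullback is a relabelling, the
  remaining vertices of \<open>Z\<close> are added one at a time, each a duplicate of a vertex of
  that image.\<close>

lemma (in relabelling) pers_betti_pull:
  fixes F :: "'f::field itself"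
  assumes pZ: "p ` Z \<subseteq> X" and A: "A \<subseteq> Pow X" "{} \<notin> A" "closed_complex A"
    and B: "B \<subseteq> Pow X" "{} \<notin> B" "closed_complex B" and AB: "A \<subseteq> B"
  shows "pers_betti F X j A B = pers_betti F Z j (pull Z p A) (pull Z p B)"
proof -
  have "pers_betti F Z j (pull (e ` X \<union> V) p A) (pull (e ` X \<union> V) p B) = pers_betti F X j A B"
    if "finite V" "V \<subseteq> Z - e ` X" for V
    using that
  proof (induction V rule: finite_induct)
    case empty
    then show ?case by (simp add: pull_relabel A B pers_betti_relabel)
  next
    case (insert v' V)
    let ?W = "e ` X \<union> V" and ?W' = "e ` X \<union> insert v' V"
    \<comment> \<open>The canonical vertex with the same image as \<open>v'\<close>; it belongs to
      every stage of the induction.\<close>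
    define v where "v = e (p v')"
    have pv': "p v' \<in> X" using insert.prems pZ by auto
    have v: "v \<in> e ` X" "v \<in> Z" "v \<noteq> v'" "p v = p v'"
    proof -
      show v1: "v \<in> e ` X" using pv' by (simp add: v_def)
      then show "v \<in> Z" using eX by blast
      show "v \<noteq> v'" using v1 insert.prems by blast
      show "p v = p v'" using pe[OF pv'] by (simp add: v_def)
    qed
    have rem: "{\<sigma> \<in> pull ?W' p C. v' \<notin> \<sigma>} = pull ?W p C" for C
      using insert.hyps insert.prems by (auto simp: pull_def)
    have "?W' \<subseteq> Z" using insert.prems eX by auto
    then have sub: "pull ?W' p C \<subseteq> Pow Z" for C
      unfolding pull_def by blast
    have dup: "insert v \<sigma> \<in> pull ?W' p C" if "\<sigma> \<in> pull ?W' p C" "v' \<in> \<sigma>" for \<sigma> C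
    proof -
      have "p ` insert v \<sigma> = p ` \<sigma>" using that(2) v(4) by auto
      then show ?thesis using that(1) v(1) by (auto simp: pull_def)
    qed
    have cl: "closed_complex (pull ?W' p C)" if "closed_complex C" for C
      unfolding closed_complex_def
    proof (intro ballI allI impI)
      fix \<sigma> \<tau> assume *: "\<sigma> \<in> pull ?W' p C" "\<tau> \<subseteq> \<sigma> \<and> \<tau> \<noteq> {}"
      then have "p ` \<tau> \<subseteq> p ` \<sigma>" "p ` \<tau> \<noteq> {}" "p ` \<sigma> \<in> C" by (auto simp: pull_def)
      then have "p ` \<tau> \<in> C" using that unfolding closed_complex_def by blast
      then show "\<tau> \<in> pull ?W' p C" using * by (auto simp: pull_def)
    qed
    have "pull ?W' p A \<subseteq> pull ?W' p B" using AB by (auto simp: pull_def)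
    then have "pers_betti F Z j (pull ?W' p A) (pull ?W' p B) =
        pers_betti F Z j {\<sigma> \<in> pull ?W' p A. v' \<notin> \<sigma>} {\<sigma> \<in> pull ?W' p B. v' \<notin> \<sigma>}"
      by (intro pers_betti_remove_duplicate[OF finZ sub sub _ v(2,3) cl[OF A(3)] cl[OF B(3)]] dup)
    then have "pers_betti F Z j (pull ?W' p A) (pull ?W' p B) = pers_betti F Z j (pull ?W p A) (pull ?W p B)"
      by (simp only: rem)
    then show ?case using insert by simp
  qed
  from this[of "Z - e ` X"] show ?thesis using finZ eX by (simp add: Un_absorb1)
qed

section \<open>Matchings of diagrams\<close>

definition near :: "real \<Rightarrow> real \<times> real \<Rightarrow> real \<times> real \<Rightarrow> bool" where
  "near \<epsilon> q q' \<longleftrightarrow> \<bar>fst q - fst q'\<bar> \<le> \<epsilon> \<and> \<bar>snd q - snd q'\<bar> \<le> \<epsilon>"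

definition diagonal :: "(real \<times> real) multiset \<Rightarrow> bool" where
  "diagonal E \<longleftrightarrow> (\<forall>q\<in>#E. fst q = snd q)"

text \<open>Padding both diagrams by arbitrary diagonal points turns a partial matching into a
  bijection, so that matchings compose.\<close>
definition matched :: "real \<Rightarrow> (real \<times> real) multiset \<Rightarrow> (real \<times> real) multiset \<Rightarrow> bool" where
  "matched \<epsilon> D D' \<longleftrightarrow> (\<exists>E E'. diagonal E \<and> diagonal E' \<and> rel_mset (near \<epsilon>) (D + E) (D' + E'))"

lemma rel_mset_add:
  assumes "rel_mset R A B" "rel_mset R C D"
  shows "rel_mset R (A + C) (B + D)"
proof -
  obtain xs ys us vs where "mset xs = A" "mset ys = B" "list_all2 R xs ys"
      "mset us = C" "mset vs = D" "list_all2 R us vs"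
    using assms by (auto simp: rel_mset_def)
  then show ?thesis
    unfolding rel_mset_def by (intro exI[of _ "xs @ us"] exI[of _ "ys @ vs"]) (simp add: list_all2_appendI)
qed

lemma rel_mset_near_refl: "0 \<le> \<epsilon> \<Longrightarrow> rel_mset (near \<epsilon>) A A"
  by (rule multiset.rel_refl) (simp add: near_def)

text \<open>Each matching is enlarged by the identity on the padding that the other one uses for
  \<open>D'\<close>. Both then share the middle term \<open>D' + E' + F\<close> and can be composed
  as relations.\<close>

lemma matched_trans:
  assumes "matched \<epsilon> D D'" "matched \<epsilon>' D' D''" "0 \<le> \<epsilon>" "0 \<le> \<epsilon>'"
  shows "matched (\<epsilon> + \<epsilon>') D D''"
proof -
  obtain E E' where E: "diagonal E" "diagonal E'" "rel_mset (near \<epsilon>) (D + E) (D' + E')"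
    using assms(1) by (auto simp: matched_def)
  obtain F F' where F: "diagonal F" "diagonal F'" "rel_mset (near \<epsilon>') (D' + F) (D'' + F')"
    using assms(2) by (auto simp: matched_def)
  have "rel_mset (near \<epsilon>) (D + E + F) (D' + E' + F)"
    by (rule rel_mset_add[OF E(3) rel_mset_near_refl[OF assms(3)]])
  moreover have "rel_mset (near \<epsilon>') (D' + F + E') (D'' + F' + E')"
    by (rule rel_mset_add[OF F(3) rel_mset_near_refl[OF assms(4)]])
  ultimately have "rel_mset (near \<epsilon> OO near \<epsilon>') (D + (E + F)) (D'' + (F' + E'))"
    by (auto simp: multiset.rel_compp relcompp_apply ac_simps intro!: exI[of _ "D' + E' + F"])
  then have "rel_mset (near (\<epsilon> + \<epsilon>')) (D + (E + F)) (D'' + (F' + E'))"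
    by (rule multiset.rel_mono_strong) (auto simp: near_def)
  moreover have "diagonal (E + F)" "diagonal (F' + E')" using E F by (auto simp: diagonal_def)
  ultimately show ?thesis unfolding matched_def by blast
qed

lemma matched_sym: "matched \<epsilon> D D' \<Longrightarrow> matched \<epsilon> D' D"
proof -
  have *: "(near \<epsilon>)\<inverse>\<inverse> = near \<epsilon>" by (auto simp: near_def fun_eq_iff abs_minus_commute)
  have "rel_mset (near \<epsilon>) B A" if "rel_mset (near \<epsilon>) A B" for A B
    using that multiset.rel_flip[of "near \<epsilon>" A B] unfolding * by simp
  then show "matched \<epsilon> D D' \<Longrightarrow> matched \<epsilon> D' D" unfolding matched_def by blast
qed

text \<open>Points of the images that the filters drop lie on the diagonal, so they serve as the
  padding.\<close>

lemma matched_image: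
  assumes "\<And>x. x \<in># M \<Longrightarrow> near \<epsilon> (f x) (g x)"
    and le: "\<And>x. x \<in># M \<Longrightarrow> fst (f x) \<le> snd (f x) \<and> fst (g x) \<le> snd (g x)"
  shows "matched \<epsilon> {#q \<in># image_mset f M. fst q < snd q#} {#q \<in># image_mset g M. fst q < snd q#}"
proof -
  let ?E = "\<lambda>f. {#q \<in># image_mset f M. \<not> fst q < snd q#}"
  have "rel_mset (near \<epsilon>) (image_mset f M) (image_mset g M)"
    unfolding multiset.rel_map by (rule multiset.rel_refl_strong) (use assms in auto)
  moreover have "image_mset f M = {#q \<in># image_mset f M. fst q < snd q#} + ?E f"
    "image_mset g M = {#q \<in># image_mset g M. fst q < snd q#} + ?E g"
    by (rule multiset_partition)+
  moreover have "diagonal (?E h)" if "\<And>x. x \<in># M \<Longrightarrow> fst (h x) \<le> snd (h x)" for h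
    unfolding diagonal_def
  proof
    fix q assume "q \<in># ?E h"
    then obtain x where "x \<in># M" "q = h x" "\<not> fst q < snd q" by auto
    then show "fst q = snd q" using that[of x] by simp
  qed
  then have "diagonal (?E f)" "diagonal (?E g)" using le by blast+
  ultimately show ?thesis unfolding matched_def by metis
qed

lemma filter_mset_split: "filter_mset p N = {#x \<in># N. p x \<and> q x#} + {#x \<in># N. p x \<and> \<not> q x#}"
  by (induction N) auto

text \<open>The matched pairs have both ends off the diagonal (\<open>P\<close>), only the first
  (\<open>U\<close>), only the second (\<open>V\<close>), or neither, and the last kind is dropped.
  Then \<open>Q\<close> consists of \<open>P\<close> and \<open>U\<close>, \<open>Q'\<close> of
  \<open>P\<close> and \<open>V\<close>, and \<open>V\<close> is no larger than \<open>U\<close>.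
  Points of \<open>U\<close> and \<open>V\<close> have persistence at most
  \<open>2 * \<epsilon>\<close>, so the half-persistence term of \<open>bcost\<close> allows them to
  be paired with each other arbitrarily.\<close>

lemma bottleneck_ge_le:
  assumes m: "matched \<epsilon> Q Q'" and \<epsilon>: "0 \<le> \<epsilon>" and sz: "size Q' \<le> size Q"
    and Q: "\<And>q. q \<in># Q \<Longrightarrow> fst q < snd q" and Q': "\<And>q. q \<in># Q' \<Longrightarrow> fst q < snd q"
  shows "bottleneck_ge Q Q' \<le> \<epsilon>"
proof -
  obtain E E' where E: "diagonal E" "diagonal E'" "rel_mset (near \<epsilon>) (Q + E) (Q' + E')"
    using m by (auto simp: matched_def)
  from E(3) obtain N where N': "set_mset N \<subseteq> {(x, y). near \<epsilon> x y}"
      and N2: "image_mset fst N = Q + E" "image_mset snd N = Q' + E'"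
    unfolding multiset.in_rel by blast
  have N1: "near \<epsilon> (fst x) (snd x)" if "x \<in># N" for x
    using subsetD[OF N' that] by (simp add: case_prod_beta)
  note N = N1 N2
  let ?d = "\<lambda>q :: real \<times> real. fst q < snd q"
  have filt: "filter_mset ?d (A + B) = A" if "\<And>q. q \<in># A \<Longrightarrow> ?d q" "diagonal B" for A B
  proof -
    have "filter_mset ?d A = A" using that(1) by (simp add: filter_mset_eq_conv)
    moreover have "filter_mset ?d B = {#}" using that(2)
      by (auto simp: diagonal_def simp flip: set_mset_eq_empty_iff)
    ultimately show ?thesis by simp
  qed
  define P where "P = {#x \<in># N. ?d (fst x) \<and> ?d (snd x)#}"
  define U where "U = {#x \<in># N. ?d (fst x) \<and> \<not> ?d (snd x)#}"
  define V where "V = {#x \<in># N. \<not> ?d (fst x) \<and> ?d (snd x)#}"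
  have "filter_mset ?d (image_mset fst N) = Q" using filt[of Q E] Q E N by simp
  then have QPU: "Q = image_mset fst P + image_mset fst U"
    unfolding P_def U_def filter_mset_image_mset image_mset_union[symmetric]
    by (subst (asm) filter_mset_split[of _ _ "\<lambda>x. ?d (snd x)"]) simp
  have "filter_mset ?d (image_mset snd N) = Q'" using filt[of Q' E'] Q' E N by simp
  then have QPV: "Q' = image_mset snd P + image_mset snd V"
    unfolding P_def V_def filter_mset_image_mset image_mset_union[symmetric]
    by (subst (asm) filter_mset_split[of _ _ "\<lambda>x. ?d (fst x)"]) (simp add: conj_commute)
  obtain ps us vs where l: "mset ps = P" "mset us = U" "mset vs = V" by (meson ex_mset)
  have len: "length vs \<le> length us"
    using sz unfolding QPU QPV l[symmetric] by simp
  define n where "n = length us - length vs"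
  define qs where "qs = map fst ps @ map fst us"
  \<comment> \<open>The surplus points of \<open>U\<close> are sent to \<open>(0, 0)\<close>; any
    diagonal point would do, since their cost is bounded by half their persistence.\<close>
  define rs where "rs = map snd ps @ map snd vs @ replicate n (0, 0)"
  have diagE: "fst (fst x) \<ge> snd (fst x) \<Longrightarrow> fst (fst x) = snd (fst x)"
    "fst (snd x) \<ge> snd (snd x) \<Longrightarrow> fst (snd x) = snd (snd x)" if "x \<in># N" for x
  proof -
    have "fst x \<in># Q + E" "snd x \<in># Q' + E'" using that N(2,3) by (metis in_image_mset imageI set_image_mset)+
    then show "fst (fst x) \<ge> snd (fst x) \<Longrightarrow> fst (fst x) = snd (fst x)"
      "fst (snd x) \<ge> snd (snd x) \<Longrightarrow> fst (snd x) = snd (snd x)"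
      using Q Q' E(1,2) by (fastforce simp: diagonal_def)+
  qed
  \<comment> \<open>The partner is on the diagonal and each coordinate moves by at most
    \<open>\<epsilon>\<close>, so the two coordinates differ by at most
    \<open>2 * \<epsilon>\<close>.\<close>
  have U2: "\<bar>snd (fst x) - fst (fst x)\<bar> \<le> 2 * \<epsilon>" if "x \<in># U" for x
    using that N(1)[of x] diagE(2)[of x] by (auto simp: U_def near_def)
  have V2: "\<bar>snd (snd x) - fst (snd x)\<bar> \<le> 2 * \<epsilon>" if "x \<in># V" for x
    using that N(1)[of x] diagE(1)[of x] by (auto simp: V_def near_def)
  have lens: "length qs = length rs" using len by (simp add: qs_def rs_def n_def)
  have cost: "bcost (qs ! i) (rs ! i) \<le> \<epsilon>" if i: "i < length qs" for i
  proof (cases "i < length ps")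
    case True
    then have "ps ! i \<in># P" by (simp flip: l(1))
    then have "ps ! i \<in># N" by (simp add: P_def)
    from N(1)[OF this] show ?thesis using True
      by (auto simp: qs_def rs_def nth_append bcost_def near_def)
  next
    case False
    define k where "k = i - length ps"
    have k: "k < length us" using i False by (simp add: qs_def k_def)
    then have "qs ! i = fst (us ! k)" using False by (simp add: qs_def nth_append k_def)
    moreover have "us ! k \<in># U" using k by (simp flip: l(2))
    ultimately have 1: "\<bar>snd (qs ! i) - fst (qs ! i)\<bar> \<le> 2 * \<epsilon>" using U2 by metis
    have 2: "\<bar>snd (rs ! i) - fst (rs ! i)\<bar> \<le> 2 * \<epsilon>"
    proof (cases "k < length vs")
      case True
      then have "rs ! i = snd (vs ! k)" using False by (simp add: rs_def nth_append k_def)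
      moreover have "vs ! k \<in># V" using True by (simp flip: l(3))
      ultimately show ?thesis using V2 by metis
    next
      case 3: False
      then have "rs ! i = (0, 0)" using False k by (simp add: rs_def nth_append k_def n_def)
      then show ?thesis using \<epsilon> by simp
    qed
    have "max \<bar>snd (qs ! i) - fst (qs ! i)\<bar> \<bar>snd (rs ! i) - fst (rs ! i)\<bar> \<le> 2 * \<epsilon>"
      using 1 2 by (rule max.boundedI)
    then show ?thesis unfolding bcost_def by (intro min.coboundedI2) simp
  qed
  define S where "S = {Max (insert 0 ((\<lambda>i. bcost (qs ! i) (ps ! i)) ` {..<length qs})) | qs ps.
       mset qs = Q \<and> (\<exists>D. mset ps = Q' + D \<and> size D = size Q - size Q' \<and> (\<forall>p\<in>#D. fst p = snd p))}"
  have "mset qs = Q" by (simp add: qs_def QPU l)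
  moreover have "mset rs = Q' + replicate_mset n (0,0)" by (simp add: rs_def QPV l)
  moreover have "size (replicate_mset n (0::real,0::real)) = size Q - size Q'"
    unfolding QPU QPV l[symmetric] n_def by simp
  ultimately have inS: "Max (insert 0 ((\<lambda>i. bcost (qs ! i) (rs ! i)) ` {..<length qs})) \<in> S"
    unfolding S_def by (force split: if_splits)
  have "bdd_below S"
    by (rule bdd_belowI[of _ 0]) (auto simp: S_def)
  then have "Inf S \<le> Max (insert 0 ((\<lambda>i. bcost (qs ! i) (rs ! i)) ` {..<length qs}))"
    by (rule cInf_lower[OF inS])
  also have "\<dots> \<le> \<epsilon>" using cost \<epsilon> by (auto simp: Max_le_iff)
  finally show ?thesis by (simp add: bottleneck_ge_def S_def)
qed

lemma bottleneck_le:
  assumes "matched \<epsilon> Q Q'" and "0 \<le> \<epsilon>"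
    and "\<And>q. q \<in># Q \<Longrightarrow> fst q < snd q" and "\<And>q. q \<in># Q' \<Longrightarrow> fst q < snd q"
  shows "bottleneck Q Q' \<le> \<epsilon>"
  using bottleneck_ge_le[OF assms(1,2)] bottleneck_ge_le[OF matched_sym[OF assms(1)] assms(2)] assms(3,4)
  unfolding bottleneck_def by simp

section \<open>Stability for filtrations of a fixed set of simplices\<close>

lemma image_mset_sum_fun: "finite A \<Longrightarrow> image_mset f (sum g A) = (\<Sum>x\<in>A. image_mset f (g x))"
  by (induction A rule: finite_induct) auto

text \<open>One-dimensional telescoping in \<open>j\<close> and then in \<open>i\<close>. The
  summand has the shape of \<open>mu\<close>, the four corners that of \<open>mult\<close>.\<close>

lemma telescope2:
  fixes r :: "nat \<Rightarrow> nat \<Rightarrow> int"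
  assumes "p \<le> p'" "q \<le> q'"
  shows "(\<Sum>i\<in>{p..<p'}. \<Sum>j\<in>{q..<q'}. r (Suc i) j - r i j - r (Suc i) (Suc j) + r i (Suc j))
    = r p' q - r p q - r p' q' + r p q'"
proof -
  have "(\<Sum>j\<in>{q..<q'}. r (Suc i) j - r i j - r (Suc i) (Suc j) + r i (Suc j))
      = (r (Suc i) q - r (Suc i) q') - (r i q - r i q')" for i
    using sum_Suc_diff'[OF assms(2), of "\<lambda>j. r i j - r (Suc i) j"]
    by (simp add: algebra_simps)
  then show ?thesis
    using sum_Suc_diff'[OF assms(1), of "\<lambda>i. r i q - r i q'"] by simp
qed

lemma down_closed_initial:
  fixes A :: "nat set"
  assumes "A \<subseteq> {..<N}" and "\<And>i j. i \<in> A \<Longrightarrow> j < i \<Longrightarrow> j \<in> A"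
  obtains p where "p \<le> N" "A = {..<p}"
proof (cases "A = {}")
  case True
  then show ?thesis using that[of 0] by simp
next
  case False
  have "finite A" using assms(1) finite_subset by blast
  then have "Max A \<in> A" "\<And>a. a \<in> A \<Longrightarrow> a \<le> Max A" using False by auto
  then have "A = {..<Suc (Max A)}" "Suc (Max A) \<le> N"
    using assms(1) assms(2)[OF \<open>Max A \<in> A\<close>] by (auto simp: less_Suc_eq_le le_less)
  then show ?thesis using that by blast
qed

lemma mono_lt_initial:
  fixes v :: "nat \<Rightarrow> real"
  assumes "\<And>i j. i \<le> j \<Longrightarrow> j < N \<Longrightarrow> v i \<le> v j"
  obtains p where "p \<le> N" "{i. i < N \<and> v i < b} = {..<p}"
proof (rule down_closed_initial)
  fix i j assume "i \<in> {i. i < N \<and> v i < b}" "j < i"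
  then show "j \<in> {i. i < N \<and> v i < b}" using assms[of j i] by simp
qed auto

lemma mono_le_initial:
  fixes v :: "nat \<Rightarrow> real"
  assumes "\<And>i j. i \<le> j \<Longrightarrow> j < N \<Longrightarrow> v i \<le> v j"
  obtains p where "p \<le> N" "{i. i < N \<and> v i \<le> b} = {..<p}"
proof (rule down_closed_initial)
  fix i j assume "i \<in> {i. i < N \<and> v i \<le> b}" "j < i"
  then show "j \<in> {i. i < N \<and> v i \<le> b}" using assms[of j i] by simp
qed auto

text \<open>The two inequalities are all that stability uses of persistent Betti numbers. They range
  over arbitrary subsets of \<open>S\<close>, so that initial segments of any sorting order are
  admissible arguments.\<close>

locale rank_function =
  fixes S :: "'c set" and R :: "'c set \<Rightarrow> 'c set \<Rightarrow> int"
  assumes finS: "finite S"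
    and R_submodular: "A' \<subseteq> A \<Longrightarrow> A \<subseteq> S \<Longrightarrow> B \<subseteq> B' \<Longrightarrow> B' \<subseteq> S \<Longrightarrow> R A' B + R A B' \<le> R A B + R A' B'"
    and R_mono: "A' \<subseteq> A \<Longrightarrow> A \<subseteq> S \<Longrightarrow> B \<subseteq> S \<Longrightarrow> R A' B \<le> R A B"
begin

definition le_set :: "('c \<Rightarrow> real) \<Rightarrow> real \<Rightarrow> 'c set" where
  "le_set f t = {s\<in>S. f s \<le> t}"

definition lt_set :: "('c \<Rightarrow> real) \<Rightarrow> real \<Rightarrow> 'c set" where
  "lt_set f t = {s\<in>S. f s < t}"

definition mult :: "('c \<Rightarrow> real) \<Rightarrow> real \<Rightarrow> real \<Rightarrow> int" where
  "mult f b d = (if d = 1 then R (le_set f b) (lt_set f 1) - R (lt_set f b) (lt_set f 1)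
     else R (le_set f b) (lt_set f d) - R (lt_set f b) (lt_set f d)
        - R (le_set f b) (le_set f d) + R (lt_set f b) (le_set f d))"

text \<open>Stated by counts, which determine the multiset; diagrams obtained from different sorting
  orders, or from the network itself, are thereby identified.\<close>

definition is_diag :: "('c \<Rightarrow> real) \<Rightarrow> (real \<times> real) multiset \<Rightarrow> bool" where
  "is_diag f D \<longleftrightarrow> (\<forall>b d. count D (b, d) = (if b < d \<and> d \<le> 1 then nat (mult f b d) else 0))"

lemma is_diag_unique: "is_diag f D \<Longrightarrow> is_diag f D' \<Longrightarrow> D = D'"
  by (rule multiset_eqI) (auto simp: is_diag_def split: prod.split)

section \<open>Diagrams of a sorted set of simplices\<close>

abbreviation n :: nat where "n \<equiv> card S"

text \<open>Index \<open>n\<close> stands for an additional last simplex of value 1 that kills every class; it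
  accounts for the convention that immortal classes die at 1.\<close>
definition rho :: "(nat \<Rightarrow> 'c) \<Rightarrow> nat \<Rightarrow> nat \<Rightarrow> int" where
  "rho e p q = (if q \<le> n then R (e ` {..<p}) (e ` {..<q}) else 0)"

text \<open>The rank formula for single steps: element \<open>i\<close> enters between the initial
  segments of lengths \<open>i\<close> and \<open>Suc i\<close>. For persistent Betti numbers this
  is the multiplicity of classes born with \<open>i\<close> and killed by \<open>j\<close>.\<close>

definition mu :: "(nat \<Rightarrow> 'c) \<Rightarrow> nat \<Rightarrow> nat \<Rightarrow> int" where
  "mu e i j = rho e (Suc i) j - rho e i j - rho e (Suc i) (Suc j) + rho e i (Suc j)"

definition index_pairs :: "(nat \<times> nat) set" where
  "index_pairs = {(i, j). i < j \<and> j \<le> n}"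

definition pairing :: "(nat \<Rightarrow> 'c) \<Rightarrow> (nat \<times> nat) multiset" where
  "pairing e = (\<Sum>x\<in>index_pairs. replicate_mset (nat (mu e (fst x) (snd x))) x)"

definition ext_val :: "(nat \<Rightarrow> 'c) \<Rightarrow> ('c \<Rightarrow> real) \<Rightarrow> nat \<Rightarrow> real" where
  "ext_val e f j = (if j < n then f (e j) else 1)"

definition diag_of :: "(nat \<Rightarrow> 'c) \<Rightarrow> ('c \<Rightarrow> real) \<Rightarrow> (real \<times> real) multiset" where
  "diag_of e f = {#q \<in># image_mset (\<lambda>(i, j). (ext_val e f i, ext_val e f j)) (pairing e). fst q < snd q#}"

definition sorts :: "(nat \<Rightarrow> 'c) \<Rightarrow> ('c \<Rightarrow> real) \<Rightarrow> bool" where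
  "sorts e f \<longleftrightarrow> bij_betw e {..<n} S \<and> (\<forall>i j. i \<le> j \<and> j < n \<longrightarrow> f (e i) \<le> f (e j))"

lemma ex_sorts: "\<exists>e. sorts e f"
proof -
  obtain xs where xs: "set xs = S" "distinct xs" using finite_distinct_list[OF finS] by blast
  define ys where "ys = sort_key f xs"
  have ys: "set ys = S" "distinct ys" "length ys = n" "sorted (map f ys)"
    using xs distinct_card[OF xs(2)] by (simp_all add: ys_def)
  have "bij_betw ((!) ys) {..<n} S" by (rule bij_betw_nth) (use ys in auto)
  moreover have "f (ys ! i) \<le> f (ys ! j)" if "i \<le> j" "j < n" for i j
    using sorted_nth_mono[OF ys(4) that(1)] that ys(3) by simp
  ultimately show ?thesis unfolding sorts_def by blast
qed

lemma finite_index_pairs: "finite index_pairs"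
  by (rule finite_subset[of _ "{..n} \<times> {..n}"]) (auto simp: index_pairs_def)

text \<open>For \<open>j < n\<close> this is submodularity. For \<open>j = n\<close> the terms with
  \<open>Suc n\<close> vanish and monotonicity in the first argument remains.\<close>

lemma mu_nonneg:
  assumes e: "bij_betw e {..<n} S" and ij: "i < j" "j \<le> n"
  shows "0 \<le> mu e i j"
proof -
  have sub: "e ` {..<p} \<subseteq> S" if "p \<le> n" for p
    using e that by (auto simp: bij_betw_def)
  have up: "e ` {..<p} \<subseteq> e ` {..<Suc p}" for p by auto
  show ?thesis
  proof (cases "j = n")
    case True
    then show ?thesis
      using R_mono[OF up[of i] sub sub[of n]] ij by (simp add: mu_def rho_def)
  next
    case False
    then show ?thesis
      using R_submodular[OF up[of i] sub up[of j] sub] ij by (simp add: mu_def rho_def)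
  qed
qed

text \<open>Since \<open>e\<close> sorts \<open>f\<close>, sublevel sets are initial segments and
  the index pairs with values \<open>(b, d)\<close> form a rectangle. Summing \<open>mu\<close> over
  it telescopes to \<open>mult f b d\<close>.\<close>

lemma is_diag_diag_of:
  assumes e: "sorts e f" and f1: "\<And>s. s \<in> S \<Longrightarrow> f s \<le> 1"
  shows "is_diag f (diag_of e f)"
  unfolding is_diag_def
proof (intro allI)
  fix b d
  have bij: "bij_betw e {..<n} S" using e by (simp add: sorts_def)
  have eS: "e i \<in> S" if "i < n" for i using bij that by (auto simp: bij_betw_def)
  let ?v = "ext_val e f"
  have v_mono: "?v i \<le> ?v j" if "i \<le> j" for i j
    using that e f1[OF eS] by (auto simp: ext_val_def sorts_def)
  have v1: "?v j \<le> 1" for j using f1[OF eS] by (auto simp: ext_val_def)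
  have "count (diag_of e f) (b, d) = (if b < d then count (image_mset (\<lambda>(i, j). (?v i, ?v j)) (pairing e)) (b, d) else 0)"
    by (simp add: diag_of_def)
  also have "count (image_mset (\<lambda>(i, j). (?v i, ?v j)) (pairing e)) (b, d)
      = (\<Sum>x\<in>index_pairs. if ?v (fst x) = b \<and> ?v (snd x) = d then nat (mu e (fst x) (snd x)) else 0)"
    unfolding pairing_def image_mset_sum_fun[OF finite_index_pairs] count_sum
    by (rule sum.cong) (auto simp: case_prod_beta)
  finally have cnt: "count (diag_of e f) (b, d) = (if b < d then
      \<Sum>x\<in>index_pairs. if ?v (fst x) = b \<and> ?v (snd x) = d then nat (mu e (fst x) (snd x)) else 0 else 0)" .
  show "count (diag_of e f) (b, d) = (if b < d \<and> d \<le> 1 then nat (mult f b d) else 0)"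
  proof (cases "b < d \<and> d \<le> 1")
    case False
    then show ?thesis unfolding cnt using v1 by (auto intro!: sum.neutral)
  next
    case True
    have img: "e ` {i. i < n \<and> P (f (e i))} = {s\<in>S. P (f s)}" for P
      using bij by (auto simp: bij_betw_def)
    have fe_mono: "f (e i) \<le> f (e j)" if "i \<le> j" "j < n" for i j
      using e that by (simp add: sorts_def)
    obtain p where p: "p \<le> n" "{i. i < n \<and> f (e i) < b} = {..<p}"
      using mono_lt_initial[of n "\<lambda>i. f (e i)" b, OF fe_mono] by metis
    obtain p' where p': "p' \<le> n" "{i. i < n \<and> f (e i) \<le> b} = {..<p'}"
      using mono_le_initial[of n "\<lambda>i. f (e i)" b, OF fe_mono] by metis
    \<comment> \<open>Deaths range over \<open>n + 1\<close> indices, because the extra index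
      \<open>n\<close> may be the second entry of a pair; births range over
      \<open>n\<close>.\<close>
    obtain q where q: "q \<le> Suc n" "{j. j < Suc n \<and> ?v j < d} = {..<q}"
      using mono_lt_initial[of "Suc n" ?v d, OF v_mono] by metis
    obtain q' where q': "q' \<le> Suc n" "{j. j < Suc n \<and> ?v j \<le> d} = {..<q'}"
      using mono_le_initial[of "Suc n" ?v d, OF v_mono] by metis
    have "{..<p} \<subseteq> {..<p'}" unfolding p(2)[symmetric] p'(2)[symmetric] by auto
    then have pp: "p \<le> p'" by simp
    have "{..<q} \<subseteq> {..<q'}" unfolding q(2)[symmetric] q'(2)[symmetric] by auto
    then have qq: "q \<le> q'" by simp
    have I: "{i. i < n \<and> f (e i) = b} = {p..<p'}"
    proof -
      have "{i. i < n \<and> f (e i) = b} = {..<p'} - {..<p}"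
        unfolding p(2)[symmetric] p'(2)[symmetric] by auto
      then show ?thesis by auto
    qed
    have J: "{j. j < Suc n \<and> ?v j = d} = {q..<q'}"
    proof -
      have "{j. j < Suc n \<and> ?v j = d} = {..<q'} - {..<q}"
        unfolding q(2)[symmetric] q'(2)[symmetric] by auto
      then show ?thesis by auto
    qed
    have set_eq: "{x\<in>index_pairs. ?v (fst x) = b \<and> ?v (snd x) = d} = {p..<p'} \<times> {q..<q'}"
    proof -
      \<comment> \<open>As \<open>b < d\<close> and the values increase, the condition
        \<open>i < j\<close> in \<open>index_pairs\<close> holds automatically on the
        rectangle.\<close>
      have lt: "i < j" if "?v i = b" "?v j = d" for i j
        using that True v_mono[of j i] by (cases "i < j") auto
      have I': "{i. i < n \<and> ?v i = b} = {p..<p'}"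
        unfolding I[symmetric] by (auto simp: ext_val_def)
      have "x \<in> index_pairs \<and> ?v (fst x) = b \<and> ?v (snd x) = d \<longleftrightarrow>
          (fst x < n \<and> ?v (fst x) = b) \<and> (snd x < Suc n \<and> ?v (snd x) = d)" for x
        using lt[of "fst x" "snd x"] by (cases x) (auto simp: index_pairs_def)
      then show ?thesis unfolding I'[symmetric] J[symmetric] by (auto simp: set_eq_iff)
    qed
    have "int (count (diag_of e f) (b, d)) =
       int (\<Sum>x\<in>{x\<in>index_pairs. ?v (fst x) = b \<and> ?v (snd x) = d}. nat (mu e (fst x) (snd x)))"
      unfolding cnt using True by (simp add: sum.inter_filter[OF finite_index_pairs])
    also have "\<dots> = (\<Sum>x\<in>{x\<in>index_pairs. ?v (fst x) = b \<and> ?v (snd x) = d}. mu e (fst x) (snd x))"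
      unfolding of_nat_sum using mu_nonneg[OF bij] by (intro sum.cong) (auto simp: index_pairs_def)
    also have "\<dots> = (\<Sum>i\<in>{p..<p'}. \<Sum>j\<in>{q..<q'}. mu e i j)"
      unfolding set_eq by (simp add: sum.cartesian_product case_prod_beta)
    also have "\<dots> = rho e p' q - rho e p q - rho e p' q' + rho e p q'"
      unfolding mu_def by (rule telescope2[OF pp qq])
    also have "\<dots> = mult f b d"
    proof -
      have ep: "e ` {..<p} = lt_set f b" "e ` {..<p'} = le_set f b"
        unfolding p(2)[symmetric] p'(2)[symmetric] lt_set_def le_set_def by (rule img)+
      have "n \<notin> {..<q}" unfolding q(2)[symmetric] using True by (simp add: ext_val_def)
      then have qn: "q \<le> n" by simp
      then have "{..<q} = {j. j < n \<and> f (e j) < d}"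
        unfolding q(2)[symmetric] using True by (auto simp: ext_val_def less_Suc_eq)
      then have eq: "e ` {..<q} = lt_set f d" using img[of "\<lambda>x. x < d"] by (simp add: lt_set_def)
      show ?thesis
      proof (cases "d = 1")
        case d1: True
        then have "n \<in> {..<q'}" unfolding q'(2)[symmetric] by (simp add: ext_val_def)
        \<comment> \<open>At \<open>n + 1\<close> the function \<open>rho\<close> is 0, so two of
          the four corners disappear, exactly as in the case \<open>d = 1\<close> of
          \<open>mult\<close>.\<close>
        then have "q' = Suc n" using q'(1) by simp
        then show ?thesis using qn d1 by (simp add: rho_def mult_def ep eq)
      next
        case d1: False
        then have "n \<notin> {..<q'}" unfolding q'(2)[symmetric] using True by (simp add: ext_val_def)
        then have qn': "q' \<le> n" by simp
        have "{..<q'} = {j. j < n \<and> f (e j) \<le> d}"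
          unfolding q'(2)[symmetric] using True d1 by (auto simp: ext_val_def less_Suc_eq)
        then have "e ` {..<q'} = le_set f d" using img[of "\<lambda>x. x \<le> d"] by (simp add: le_set_def)
        then show ?thesis using qn qn' d1 by (simp add: rho_def mult_def ep eq)
      qed
    qed
    finally have "count (diag_of e f) (b, d) = nat (mult f b d)" by (metis nat_int)
    then show ?thesis using True by simp
  qed
qed

lemma matched_diag_of:
  assumes "sorts e f" "sorts e g" and f1: "\<And>s. s \<in> S \<Longrightarrow> f s \<le> 1" and g1: "\<And>s. s \<in> S \<Longrightarrow> g s \<le> 1"
    and \<epsilon>: "0 \<le> \<epsilon>" and near: "\<And>s. s \<in> S \<Longrightarrow> \<bar>f s - g s\<bar> \<le> \<epsilon>"
  shows "matched \<epsilon> (diag_of e f) (diag_of e g)"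
  unfolding diag_of_def
proof (rule matched_image)
  have eS: "e i \<in> S" if "i < n" for i using assms(1) that by (auto simp: bij_betw_def sorts_def)
  have v_near: "\<bar>ext_val e f j - ext_val e g j\<bar> \<le> \<epsilon>" for j
    using near[OF eS] \<epsilon> by (simp add: ext_val_def)
  fix x assume "x \<in># pairing e"
  then have "x \<in> index_pairs"
    unfolding pairing_def using finite_index_pairs by (auto simp: set_mset_sum split: if_splits)
  then obtain i j where x: "x = (i, j)" "i < j" "j \<le> n" by (auto simp: index_pairs_def)
  show "near \<epsilon> (case x of (i, j) \<Rightarrow> (ext_val e f i, ext_val e f j))
      (case x of (i, j) \<Rightarrow> (ext_val e g i, ext_val e g j))"
    using v_near by (simp add: near_def x)
  have "ext_val e h i \<le> ext_val e h j" if "sorts e h" "\<And>s. s \<in> S \<Longrightarrow> h s \<le> 1" for h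
    using that x eS by (auto simp: ext_val_def sorts_def)
  then show "fst (case x of (i, j) \<Rightarrow> (ext_val e f i, ext_val e f j))
      \<le> snd (case x of (i, j) \<Rightarrow> (ext_val e f i, ext_val e f j)) \<and>
    fst (case x of (i, j) \<Rightarrow> (ext_val e g i, ext_val e g j))
      \<le> snd (case x of (i, j) \<Rightarrow> (ext_val e g i, ext_val e g j))"
    using assms(1,2) f1 g1 by (simp add: x)
qed

theorem stability:
  assumes f1: "\<And>s. s \<in> S \<Longrightarrow> f s \<le> 1" and g1: "\<And>s. s \<in> S \<Longrightarrow> g s \<le> 1"
    and \<delta>: "0 \<le> \<delta>" and near: "\<And>s. s \<in> S \<Longrightarrow> \<bar>f s - g s\<bar> \<le> \<delta>"
    and D: "is_diag f D" and D': "is_diag g D'"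
  shows "matched \<delta> D D'"
proof -
  define h where "h = (\<lambda>t s. (1 - t) * f s + t * g s)"
  have h1: "h t s \<le> 1" if "0 \<le> t" "t \<le> 1" "s \<in> S" for t s
    unfolding h_def using that f1[OF that(3)] g1[OF that(3)] by (intro convex_bound_le) auto
  have h_near: "\<bar>h x s - h y s\<bar> \<le> \<bar>x - y\<bar> * \<delta>" if "s \<in> S" for x y s
  proof -
    have "h x s - h y s = (y - x) * (f s - g s)" by (simp add: h_def algebra_simps)
    then show ?thesis using mult_left_mono[OF near[OF that], of "\<bar>x - y\<bar>"]
      by (simp add: abs_mult abs_minus_commute)
  qed
  \<comment> \<open>The bounds 0 and 1 are premises because the bisection principle also tests
    intervals that leave \<open>[0, 1]\<close>. The factor \<open>b - a\<close> makes the errors of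
    adjacent intervals add up exactly.\<close>
  define P where "P = (\<lambda>a b. 0 \<le> a \<longrightarrow> b \<le> 1 \<longrightarrow> a \<le> b \<longrightarrow>
     (\<forall>D D'. is_diag (h a) D \<longrightarrow> is_diag (h b) D' \<longrightarrow> matched ((b - a) * \<delta>) D D'))"
  have trans: "P a c" if P: "P a b" "P b c" and le: "a \<le> b" "b \<le> c" for a b c
    unfolding P_def
  proof (intro impI allI)
    fix D D'' assume *: "0 \<le> a" "c \<le> 1" "is_diag (h a) D" "is_diag (h c) D''"
    \<comment> \<open>Composition passes through an actual diagram at \<open>b\<close>, which any
      sorting order supplies.\<close>
    obtain e where "sorts e (h b)" using ex_sorts by blast
    then have "is_diag (h b) (diag_of e (h b))"
      by (rule is_diag_diag_of) (rule h1, use * le in auto)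
    then have "matched ((b - a) * \<delta>) D (diag_of e (h b))" "matched ((c - b) * \<delta>) (diag_of e (h b)) D''"
      using P * le unfolding P_def by auto
    then have "matched ((b - a) * \<delta> + (c - b) * \<delta>) D D''"
      by (rule matched_trans) (use le \<delta> in auto)
    then show "matched ((c - a) * \<delta>) D D''" by (simp add: algebra_simps)
  qed
  have local: "\<exists>\<eta>>0. \<forall>y. \<bar>y - x\<bar> < \<eta> \<longrightarrow> 0 \<le> y \<longrightarrow> y \<le> 1 \<longrightarrow>
      (\<forall>D D'. is_diag (h x) D \<longrightarrow> is_diag (h y) D' \<longrightarrow> matched (\<bar>y - x\<bar> * \<delta>) D D')"
    if x: "0 \<le> x" "x \<le> 1" for x
  proof -
    have "\<forall>\<^sub>F y in nhds x. \<forall>s\<in>S. \<forall>s'\<in>S. h x s < h x s' \<longrightarrow> h y s < h y s'"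
    proof (intro eventually_ball_finite[OF finS] ballI)
      fix s s'
      show "\<forall>\<^sub>F y in nhds x. h x s < h x s' \<longrightarrow> h y s < h y s'"
      proof (cases "h x s < h x s'")
        case True
        have "((\<lambda>y. h y s' - h y s) \<longlongrightarrow> h x s' - h x s) (nhds x)"
          unfolding h_def by (intro tendsto_intros filterlim_ident)
        from order_tendstoD(1)[OF this, of 0] True show ?thesis
          by (auto elim: eventually_mono)
      qed simp
    qed
    then obtain \<eta> where \<eta>: "\<eta> > 0"
      "\<And>y s s'. dist y x < \<eta> \<Longrightarrow> s \<in> S \<Longrightarrow> s' \<in> S \<Longrightarrow> h x s < h x s' \<Longrightarrow> h y s < h y s'"
      unfolding eventually_nhds_metric by blast
    show ?thesis
    proof (intro exI[of _ \<eta>] conjI \<eta>(1) allI impI)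
      fix y D D' assume y: "\<bar>y - x\<bar> < \<eta>" "0 \<le> y" "y \<le> 1"
        and D: "is_diag (h x) D" "is_diag (h y) D'"
      \<comment> \<open>The order is chosen at \<open>y\<close>, not at \<open>x\<close>. Strict
        inequalities at \<open>x\<close> persist at \<open>y\<close>, so this order sorts
        \<open>h x\<close> too, with ties at \<open>x\<close> broken as \<open>h y\<close>
        demands.\<close>
      obtain e where e: "sorts e (h y)" using ex_sorts by blast
      have eS: "e i \<in> S" if "i < n" for i using e that by (auto simp: bij_betw_def sorts_def)
      have "h x (e i) \<le> h x (e j)" if ij: "i \<le> j" "j < n" for i j
      proof (rule ccontr)
        assume "\<not> h x (e i) \<le> h x (e j)"
        then have "h y (e j) < h y (e i)" using \<eta>(2)[of y "e j" "e i"] y(1) eS ij by (simp add: dist_real_def)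
        then show False using e ij by (force simp: sorts_def)
      qed
      then have ex: "sorts e (h x)" using e by (simp add: sorts_def)
      have "is_diag (h x) (diag_of e (h x))" "is_diag (h y) (diag_of e (h y))"
        by (rule is_diag_diag_of; use ex e h1 x y in auto)+
      then have "D = diag_of e (h x)" "D' = diag_of e (h y)" using D is_diag_unique by blast+
      moreover have "matched (\<bar>y - x\<bar> * \<delta>) (diag_of e (h x)) (diag_of e (h y))"
        by (rule matched_diag_of[OF ex e])
          (use h1 x y \<delta> h_near[of _ x y] in \<open>auto simp: abs_minus_commute\<close>)
      ultimately show "matched (\<bar>y - x\<bar> * \<delta>) D D'" by simp
    qed
  qed
  have "P 0 1"
  proof (rule Bolzano)
    show "(0::real) \<le> 1" by simp
    show "P a c" if "P a b" "P b c" "a \<le> b" "b \<le> c" for a b c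
      using trans[OF that] .
    fix x :: real assume x: "0 \<le> x" "x \<le> 1"
    obtain \<eta> where \<eta>: "\<eta> > 0" "\<And>y D D'. \<bar>y - x\<bar> < \<eta> \<Longrightarrow> 0 \<le> y \<Longrightarrow> y \<le> 1 \<Longrightarrow>
       is_diag (h x) D \<Longrightarrow> is_diag (h y) D' \<Longrightarrow> matched (\<bar>y - x\<bar> * \<delta>) D D'"
      using local[OF x] by blast
    show "\<exists>d>0. \<forall>a b. a \<le> x \<and> x \<le> b \<and> b - a < d \<longrightarrow> P a b"
    proof (intro exI[of _ \<eta>] conjI \<eta>(1) allI impI)
      fix a b assume ab: "a \<le> x \<and> x \<le> b \<and> b - a < \<eta>"
      have "P a x"
        unfolding P_def
      proof (intro impI allI)
        fix D D' assume *: "0 \<le> a" "is_diag (h a) D" "is_diag (h x) D'"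
        have "matched (\<bar>a - x\<bar> * \<delta>) D' D" by (rule \<eta>(2)) (use * ab x in auto)
        then show "matched ((x - a) * \<delta>) D D'" using matched_sym ab by (simp add: abs_if split: if_splits)
      qed
      moreover have "P x b"
        unfolding P_def
      proof (intro impI allI)
        fix D D' assume *: "b \<le> 1" "is_diag (h x) D" "is_diag (h b) D'"
        have "matched (\<bar>b - x\<bar> * \<delta>) D D'" by (rule \<eta>(2)) (use * ab x in auto)
        then show "matched ((b - x) * \<delta>) D D'" using ab by simp
      qed
      ultimately show "P a b" using trans ab by blast
    qed
  qed
  moreover have "h 0 = f" "h 1 = g" by (auto simp: h_def)
  ultimately show ?thesis using D D' by (simp add: P_def)
qed

end

section \<open>Filtrations of dissimilarity networks\<close>

text \<open>Simplices are vertex sets while networks evaluate tuples; the sorted list without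
  repetitions serves as the representative.\<close>

definition set_val :: "(nat \<Rightarrow> 'a::linorder list \<Rightarrow> real) \<Rightarrow> 'a set \<Rightarrow> real" where
  "set_val r \<sigma> = r (card \<sigma> - 1) (sorted_list_of_set \<sigma>)"

locale finite_dissim_network =
  fixes K :: nat and X :: "'a::linorder set" and r :: "nat \<Rightarrow> 'a list \<Rightarrow> real"
  assumes finX: "finite X" and dn: "dissim_network K X r"
begin

lemma r_bounds: "k \<le> K \<Longrightarrow> length xs = Suc k \<Longrightarrow> set xs \<subseteq> X \<Longrightarrow> 0 \<le> r k xs \<and> r k xs \<le> 1"
  using dn unfolding dissim_network_def network_def by blast

lemma r_sym:
  assumes "k \<le> K" "length xs = Suc k" "length ys = Suc k" "set xs \<subseteq> X" "set xs = set ys"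
  shows "r k xs = r k ys"
proof -
  have "\<forall>k\<le>K. \<forall>xs ys. length xs = Suc k \<and> length ys = Suc k \<and> set xs \<subseteq> X \<and> set ys \<subseteq> X
         \<and> set xs = set ys \<longrightarrow> r k xs = r k ys"
    using dn unfolding dissim_network_def network_def by (elim conjE)
  from this[rule_format, of k xs ys] show ?thesis using assms by simp
qed

lemma r_snoc:
  assumes "Suc k \<le> K" "length xs = Suc k" "set xs \<subseteq> X" "x \<in> X"
  shows "r k xs \<le> r (Suc k) (xs @ [x])" "x \<in> set xs \<Longrightarrow> r (Suc k) (xs @ [x]) = r k xs"
proof -
  have *: "\<forall>zs. length zs = Suc (Suc k) \<and> set zs \<subseteq> X \<longrightarrow> r k (butlast zs) \<le> r (Suc k) zs \<and>
      (r (Suc k) zs = r k (butlast zs) \<longleftrightarrow> set zs = set (butlast zs))"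
    using conjunct2[OF dn[unfolded dissim_network_def], rule_format, of "Suc k"] assms(1) by simp
  show "r k xs \<le> r (Suc k) (xs @ [x])" "x \<in> set xs \<Longrightarrow> r (Suc k) (xs @ [x]) = r k xs"
    using *[rule_format, of "xs @ [x]"] assms by auto
qed

text \<open>By symmetry a repeated entry can be moved to the end, where the equality case of the
  dissimilarity condition removes it. Lists without repetitions differ from the sorted one only in
  order.\<close>

lemma r_eq_set_val: "k \<le> K \<Longrightarrow> length xs = Suc k \<Longrightarrow> set xs \<subseteq> X \<Longrightarrow> r k xs = set_val r (set xs)"
proof (induction k arbitrary: xs)
  case 0
  then obtain x where "xs = [x]" by (auto simp: length_Suc_conv)
  then show ?case by (simp add: set_val_def)
next
  case (Suc k)
  show ?case
  proof (cases "distinct xs")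
    case True
    then have c: "card (set xs) = Suc (Suc k)" using Suc.prems by (simp add: distinct_card)
    have "r (Suc k) xs = r (Suc k) (sorted_list_of_set (set xs))"
      by (rule r_sym) (use Suc.prems c in auto)
    then show ?thesis by (simp add: set_val_def c)
  next
    case False
    then obtain as y bs cs where xs: "xs = as @ [y] @ bs @ [y] @ cs"
      using not_distinct_decomp by blast
    define ys where "ys = as @ [y] @ bs @ cs"
    have ys: "length ys = Suc k" "set ys = set xs" "y \<in> set ys" using Suc.prems xs by (auto simp: ys_def)
    have "r (Suc k) xs = r (Suc k) (ys @ [y])"
      by (rule r_sym) (use Suc.prems ys in auto)
    also have "\<dots> = r k ys" by (rule r_snoc(2)) (use Suc.prems ys in auto)
    also have "\<dots> = set_val r (set xs)" using Suc.IH[of ys] Suc.prems ys by simp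
    finally show ?thesis .
  qed
qed

lemma r_append_le: "length (xs @ ys) \<le> Suc K \<Longrightarrow> xs \<noteq> [] \<Longrightarrow> set (xs @ ys) \<subseteq> X \<Longrightarrow>
    r (length xs - 1) xs \<le> r (length (xs @ ys) - 1) (xs @ ys)"
proof (induction ys rule: rev_induct)
  case (snoc y ys)
  obtain k where k: "length (xs @ ys) = Suc k" using snoc.prems(2) by (cases xs) auto
  have "r (length xs - 1) xs \<le> r k (xs @ ys)" using snoc k by simp
  also have "\<dots> \<le> r (Suc k) ((xs @ ys) @ [y])"
    by (rule r_snoc(1)) (use snoc.prems k in auto)
  finally show ?case using k by simp
qed simp

lemma set_val_mono:
  assumes "\<sigma> \<subseteq> \<tau>" "\<sigma> \<noteq> {}" "\<tau> \<subseteq> X" "card \<tau> \<le> Suc K"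
  shows "set_val r \<sigma> \<le> set_val r \<tau>"
proof -
  have fin: "finite \<tau>" "finite \<sigma>" using assms finX by (meson finite_subset)+
  define xs where "xs = sorted_list_of_set \<sigma>"
  define ys where "ys = sorted_list_of_set (\<tau> - \<sigma>)"
  have s: "set xs = \<sigma>" "set ys = \<tau> - \<sigma>" "length xs = card \<sigma>" using fin by (simp_all add: xs_def ys_def)
  have len: "length (xs @ ys) = card \<tau>"
    using card_mono[OF fin(1) assms(1)] fin assms(1) by (simp add: xs_def ys_def card_Diff_subset)
  have st: "set (xs @ ys) = \<tau>" using s assms(1) by auto
  have ne: "xs \<noteq> []" using s assms(2) by auto
  have pos: "card \<tau> = Suc (card \<tau> - 1)" using fin assms by (cases "card \<tau>") auto
  have "set_val r \<sigma> = r (length xs - 1) xs" by (simp add: set_val_def xs_def)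
  also have "\<dots> \<le> r (length (xs @ ys) - 1) (xs @ ys)"
    by (rule r_append_le) (use len assms(3,4) ne st in auto)
  also have "\<dots> = set_val r (set (xs @ ys))"
    by (rule r_eq_set_val) (use len pos assms(3,4) st in auto)
  finally show ?thesis by (simp only: st)
qed

lemma sorted_list_props:
  assumes "\<sigma> \<subseteq> X" "\<sigma> \<noteq> {}" "card \<sigma> \<le> Suc K"
  shows "card \<sigma> - 1 \<le> K" "length (sorted_list_of_set \<sigma>) = Suc (card \<sigma> - 1)"
    "set (sorted_list_of_set \<sigma>) = \<sigma>"
proof -
  have "finite \<sigma>" using assms(1) finX by (rule finite_subset)
  then show "card \<sigma> - 1 \<le> K" "length (sorted_list_of_set \<sigma>) = Suc (card \<sigma> - 1)"
    "set (sorted_list_of_set \<sigma>) = \<sigma>" using assms card_gt_0_iff[of \<sigma>] by auto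
qed

text \<open>The predicate \<open>P\<close> stands for the conditions \<open>\<le> t\<close>,
  \<open>< t\<close> and \<open>= v\<close>, which give \<open>filt\<close>, \<open>filt_lt\<close>
  and \<open>crit_vals\<close>.\<close>

lemma simplices_iff:
  "(\<exists>k\<le>K. \<exists>xs. length xs = Suc k \<and> set xs \<subseteq> X \<and> set xs = \<sigma> \<and> P (r k xs)) \<longleftrightarrow>
    \<sigma> \<subseteq> X \<and> \<sigma> \<noteq> {} \<and> card \<sigma> \<le> Suc K \<and> P (set_val r \<sigma>)" (is "?L \<longleftrightarrow> ?R")
proof
  assume ?L
  then obtain k xs where *: "k \<le> K" "length xs = Suc k" "set xs \<subseteq> X" "set xs = \<sigma>" "P (r k xs)" by blast
  then have "card \<sigma> \<le> Suc K" using card_length[of xs] by simp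
  then show ?R using * r_eq_set_val[of k xs] by auto
next
  assume R: ?R
  then show ?L
    using sorted_list_props[of \<sigma>] unfolding set_val_def
    by (intro exI[of _ "card \<sigma> - 1"] conjI exI[of _ "sorted_list_of_set \<sigma>"]) auto
qed

lemma filt_iff: "\<sigma> \<in> filt K X r t \<longleftrightarrow> \<sigma> \<subseteq> X \<and> \<sigma> \<noteq> {} \<and> card \<sigma> \<le> Suc K \<and> set_val r \<sigma> \<le> t"
  unfolding filt_def using simplices_iff[of \<sigma> "\<lambda>v. v \<le> t"] by simp

lemma filt_lt_iff: "\<sigma> \<in> filt_lt K X r t \<longleftrightarrow> \<sigma> \<subseteq> X \<and> \<sigma> \<noteq> {} \<and> card \<sigma> \<le> Suc K \<and> set_val r \<sigma> < t"
  unfolding filt_lt_def using simplices_iff[of \<sigma> "\<lambda>v. v < t"] by simp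

lemma crit_vals_iff: "v \<in> crit_vals K X r \<longleftrightarrow> (\<exists>\<sigma>. \<sigma> \<subseteq> X \<and> \<sigma> \<noteq> {} \<and> card \<sigma> \<le> Suc K \<and> set_val r \<sigma> = v)"
proof -
  have "v \<in> crit_vals K X r \<longleftrightarrow>
      (\<exists>\<sigma>. \<exists>k\<le>K. \<exists>xs. length xs = Suc k \<and> set xs \<subseteq> X \<and> set xs = \<sigma> \<and> r k xs = v)"
    unfolding crit_vals_def by auto
  then show ?thesis by (simp only: simplices_iff[of _ "\<lambda>w. w = v"])
qed

lemma set_val_bounds:
  assumes "\<sigma> \<subseteq> X" "\<sigma> \<noteq> {}" "card \<sigma> \<le> Suc K"
  shows "set_val r \<sigma> \<le> 1"
  using sorted_list_props[OF assms] r_bounds assms(1) by (simp add: set_val_def)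

lemma finite_crit_vals: "finite (crit_vals K X r)"
proof (rule finite_subset)
  show "crit_vals K X r \<subseteq> set_val r ` Pow X" by (auto simp: crit_vals_iff)
qed (use finX in simp)

lemma closed_complex_filt: "closed_complex (filt K X r t)"
  unfolding closed_complex_def
proof (intro ballI allI impI)
  fix \<sigma> \<tau> assume *: "\<sigma> \<in> filt K X r t" "\<tau> \<subseteq> \<sigma> \<and> \<tau> \<noteq> {}"
  then have "finite \<sigma>" using finX finite_subset by (auto simp: filt_iff)
  then have "card \<tau> \<le> card \<sigma>" using * card_mono by blast
  then show "\<tau> \<in> filt K X r t"
    using * set_val_mono[of \<tau> \<sigma>] by (auto simp: filt_iff)
qed

lemma closed_complex_filt_lt: "closed_complex (filt_lt K X r t)"
  unfolding closed_complex_def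
proof (intro ballI allI impI)
  fix \<sigma> \<tau> assume *: "\<sigma> \<in> filt_lt K X r t" "\<tau> \<subseteq> \<sigma> \<and> \<tau> \<noteq> {}"
  then have "finite \<sigma>" using finX finite_subset by (auto simp: filt_lt_iff)
  then have "card \<tau> \<le> card \<sigma>" using * card_mono by blast
  then show "\<tau> \<in> filt_lt K X r t"
    using * set_val_mono[of \<tau> \<sigma>] by (auto simp: filt_lt_iff)
qed

lemma filt_eq_filt_lt: "t \<notin> crit_vals K X r \<Longrightarrow> filt K X r t = filt_lt K X r t"
  unfolding set_eq_iff filt_iff filt_lt_iff crit_vals_iff by (auto simp: le_less)

text \<open>At a value that is not critical, \<open>filt\<close> and \<open>filt_lt\<close> agree
  and the alternating sum vanishes. So summing over critical pairs loses no point, and no death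
  exceeds 1.\<close>

lemma count_pers_diag:
  "count (pers_diag F K X r j) (b, d) = (if b < d \<and> d \<le> 1 then nat (pd_mult F K X r j b d) else 0)"
proof -
  define P where "P = {(b, d). b \<in> crit_vals K X r \<and> d \<in> insert 1 (crit_vals K X r) \<and> b < d}"
  have "finite P"
    by (rule finite_subset[of _ "crit_vals K X r \<times> insert 1 (crit_vals K X r)"])
      (auto simp: P_def finite_crit_vals)
  have "count (pers_diag F K X r j) (b, d) =
      (\<Sum>p\<in>P. if p = (b, d) then nat (pd_mult F K X r j (fst p) (snd p)) else 0)"
    unfolding pers_diag_def P_def[symmetric] count_sum by (rule sum.cong) auto
  also have "\<dots> = (if (b, d) \<in> P then nat (pd_mult F K X r j b d) else 0)"
    using \<open>finite P\<close> by simp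
  also have "\<dots> = (if b < d \<and> d \<le> 1 then nat (pd_mult F K X r j b d) else 0)"
  proof (cases "b < d \<and> d \<le> 1")
    case True
    have "pd_mult F K X r j b d = 0" if "(b, d) \<notin> P"
      using that True filt_eq_filt_lt[of b] filt_eq_filt_lt[of d] by (auto simp: P_def pd_mult_def)
    then show ?thesis using True by simp
  next
    case False
    have "c \<le> 1" if "c \<in> crit_vals K X r" for c using that set_val_bounds by (auto simp: crit_vals_iff)
    then have "(b, d) \<notin> P" using False by (auto simp: P_def)
    then show ?thesis using False by auto
  qed
  finally show ?thesis .
qed

end

text \<open>The carriers of \<open>j\<close>-chains and \<open>(j+1)\<close>-chains. For
  \<open>j < K\<close> their images have at most \<open>K + 1\<close> vertices, so every one of them
  has a value in the network.\<close>

definition rel_simplices :: "'a set \<Rightarrow> nat \<Rightarrow> 'a set set" where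
  "rel_simplices Z j = {\<sigma>. \<sigma> \<subseteq> Z \<and> (card \<sigma> = Suc j \<or> card \<sigma> = Suc (Suc j))}"

section \<open>Persistence diagrams computed on a cover\<close>

lemma rank_function_pers_betti:
  assumes "finite Z"
  shows "rank_function (rel_simplices Z j) (pers_betti F Z j)"
proof
  have sub: "rel_simplices Z j \<subseteq> Pow Z" by (auto simp: rel_simplices_def)
  show "finite (rel_simplices Z j)" by (rule finite_subset[OF sub]) (use assms in simp)
  show "pers_betti F Z j A' B + pers_betti F Z j A B' \<le> pers_betti F Z j A B + pers_betti F Z j A' B'"
    if "A' \<subseteq> A" "A \<subseteq> rel_simplices Z j" "B \<subseteq> B'" "B' \<subseteq> rel_simplices Z j" for A A' B B'
    by (rule pers_betti_submodular[OF assms]) (use that sub in auto)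
  show "pers_betti F Z j A' B \<le> pers_betti F Z j A B"
    if "A' \<subseteq> A" "A \<subseteq> rel_simplices Z j" "B \<subseteq> rel_simplices Z j" for A A' B
    by (rule pers_betti_mono[OF assms]) (use that sub in auto)
qed

lemma pers_betti_cong:
  fixes F :: "'f::field itself"
  assumes "(chains A j :: ('a::linorder set \<Rightarrow> 'f) set) = chains A' j"
    and "(chains B (Suc j) :: ('a set \<Rightarrow> 'f) set) = chains B' (Suc j)"
  shows "pers_betti F X j A B = pers_betti F X j A' B'"
  unfolding pers_betti_def cycles_def boundaries_def assms ..

lemma pers_betti_rel_simplices:
  assumes "A \<subseteq> Pow Z" "B \<subseteq> Pow Z"
  shows "pers_betti F Z j A B = pers_betti F Z j (A \<inter> rel_simplices Z j) (B \<inter> rel_simplices Z j)"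
  by (rule pers_betti_cong) (use assms in \<open>auto simp: chains_def rel_simplices_def\<close>)

locale network_cover = relabelling X Z e p + finite_dissim_network K X r
  for X :: "'a::linorder set" and Z :: "'b::linorder set" and e p K r +
  assumes pZ: "p ` Z \<subseteq> X"
begin

lemma p_simplex:
  assumes "\<sigma> \<in> rel_simplices Z j" "j < K"
  shows "p ` \<sigma> \<subseteq> X" "p ` \<sigma> \<noteq> {}" "card (p ` \<sigma>) \<le> Suc K"
proof -
  have "finite \<sigma>" using assms finZ finite_subset by (auto simp: rel_simplices_def)
  then have "card (p ` \<sigma>) \<le> card \<sigma>" by (rule card_image_le)
  then show "p ` \<sigma> \<subseteq> X" "p ` \<sigma> \<noteq> {}" "card (p ` \<sigma>) \<le> Suc K"
    using assms pZ by (auto simp: rel_simplices_def)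
qed

text \<open>Cut down to the relevant simplices, the pulled-back levels are sublevel sets of one
  function on \<open>rel_simplices Z j\<close>, and pulling back keeps all ranks. Diagrams of
  different networks thus become comparable on the same \<open>Z\<close>.\<close>

lemma is_diag_pers_diag:
  fixes F :: "'f::field itself"
  assumes j: "j < K"
  shows "rank_function.is_diag (rel_simplices Z j) (pers_betti F Z j)
    (\<lambda>\<sigma>. set_val r (p ` \<sigma>)) (pers_diag F K X r j)"
proof -
  interpret R: rank_function "rel_simplices Z j" "pers_betti F Z j"
    by (rule rank_function_pers_betti[OF finZ])
  let ?g = "\<lambda>\<sigma>. set_val r (p ` \<sigma>)"
  have le: "pull Z p (filt K X r t) \<inter> rel_simplices Z j = R.le_set ?g t" for t
  proof (rule set_eqI)
    fix \<sigma>
    have "\<sigma> \<subseteq> Z \<and> \<sigma> \<noteq> {}" if "\<sigma> \<in> rel_simplices Z j"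
      using that p_simplex(2)[OF that j] by (auto simp: rel_simplices_def)
    then show "\<sigma> \<in> pull Z p (filt K X r t) \<inter> rel_simplices Z j \<longleftrightarrow> \<sigma> \<in> R.le_set ?g t"
      using p_simplex[OF _ j, of \<sigma>] by (simp add: pull_def filt_iff R.le_set_def) blast
  qed
  have lt: "pull Z p (filt_lt K X r t) \<inter> rel_simplices Z j = R.lt_set ?g t" for t
  proof (rule set_eqI)
    fix \<sigma>
    have "\<sigma> \<subseteq> Z \<and> \<sigma> \<noteq> {}" if "\<sigma> \<in> rel_simplices Z j"
      using that p_simplex(2)[OF that j] by (auto simp: rel_simplices_def)
    then show "\<sigma> \<in> pull Z p (filt_lt K X r t) \<inter> rel_simplices Z j \<longleftrightarrow> \<sigma> \<in> R.lt_set ?g t"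
      using p_simplex[OF _ j, of \<sigma>] by (simp add: pull_def filt_lt_iff R.lt_set_def) blast
  qed
  have pb: "pers_betti F X j A B = pers_betti F Z j (pull Z p A \<inter> rel_simplices Z j) (pull Z p B \<inter> rel_simplices Z j)"
    if "A \<in> range (filt K X r) \<union> range (filt_lt K X r)" "B \<in> range (filt K X r) \<union> range (filt_lt K X r)"
      "A \<subseteq> B" for A B
  proof -
    have lev: "C \<subseteq> Pow X \<and> {} \<notin> C \<and> closed_complex C"
      if "C \<in> range (filt K X r) \<union> range (filt_lt K X r)" for C
      using that closed_complex_filt closed_complex_filt_lt by (auto simp: filt_iff filt_lt_iff)
    have "pers_betti F X j A B = pers_betti F Z j (pull Z p A) (pull Z p B)"
      by (rule pers_betti_pull[OF pZ]) (use lev that in auto)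
    also have "\<dots> = pers_betti F Z j (pull Z p A \<inter> rel_simplices Z j) (pull Z p B \<inter> rel_simplices Z j)"
      by (rule pers_betti_rel_simplices) (auto simp: pull_def)
    finally show ?thesis .
  qed
  have "pd_mult F K X r j b d = R.mult ?g b d" if "b < d" for b d
  proof -
    have sub: "filt K X r b \<subseteq> filt_lt K X r d" "filt_lt K X r b \<subseteq> filt_lt K X r d"
      "filt K X r b \<subseteq> filt K X r d" "filt_lt K X r b \<subseteq> filt K X r d"
      using that by (auto simp: filt_iff filt_lt_iff)
    show ?thesis
      unfolding pd_mult_def R.mult_def using sub by (auto simp: pb le lt)
  qed
  then show ?thesis unfolding R.is_diag_def count_pers_diag by simp
qed

end

text \<open>Counting the smaller elements places vertex sets of two unrelated ordered types into
  \<open>nat\<close> without changing their orders.\<close>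

lemma ex_rank_embedding:
  assumes "finite (X :: 'a::linorder set)"
  shows "\<exists>e :: 'a \<Rightarrow> nat. (\<forall>x\<in>X. \<forall>y\<in>X. x < y \<longrightarrow> e x < e y) \<and> (\<forall>x\<in>X. e x < card X)"
proof (intro exI[of _ "\<lambda>x. card {u\<in>X. u < x}"] conjI ballI impI)
  fix x y assume xy: "x \<in> X" "y \<in> X" "x < y"
  then have "{u\<in>X. u < x} \<subset> {u\<in>X. u < y}" by auto
  then show "card {u\<in>X. u < x} < card {u\<in>X. u < y}" using assms by (intro psubset_card_mono) auto
next
  fix x assume "x \<in> X"
  then have "{u\<in>X. u < x} \<subset> X" by auto
  then show "card {u\<in>X. u < x} < card X" using assms by (intro psubset_card_mono) auto
qed

section \<open>Correspondences and their common covers\<close>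

lemma Gamma_ge:
  assumes "finite C" "length zs = Suc k" "set zs \<subseteq> C"
  shows "\<bar>rX k (map fst zs) - rY k (map snd zs)\<bar> \<le> Gamma rX rY k C"
proof -
  have "{zs. length zs = Suc k \<and> set zs \<subseteq> C} = {zs. set zs \<subseteq> C \<and> length zs = Suc k}" by auto
  then have "finite {zs. length zs = Suc k \<and> set zs \<subseteq> C}"
    using finite_lists_length_eq[OF assms(1)] by simp
  then show ?thesis unfolding Gamma_def by (intro Max_ge) (use assms in auto)
qed

lemma net_dist_attained:
  assumes "finite X" "finite Y" "X \<noteq> {}" "Y \<noteq> {}"
  obtains C where "correspondence X Y C" "net_dist X rX Y rY k = Gamma rX rY k C"
proof -
  have "{C. correspondence X Y C} \<subseteq> Pow (X \<times> Y)" by (auto simp: correspondence_def)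
  then have "finite {C. correspondence X Y C}" by (rule finite_subset) (use assms in simp)
  moreover have "correspondence X Y (X \<times> Y)" using assms by (simp add: correspondence_def)
  ultimately have "net_dist X rX Y rY k \<in> Gamma rX rY k ` {C. correspondence X Y C}"
    unfolding net_dist_def by (intro Min_in) auto
  then show ?thesis using that by auto
qed

text \<open>Padding by repetitions lets \<open>Gamma\<close> at order \<open>k\<close> control
  simplices with fewer than \<open>k + 1\<close> vertices.\<close>

lemma ex_list_of_length:
  assumes "finite \<sigma>" "\<sigma> \<noteq> {}" "card \<sigma> \<le> m"
  shows "\<exists>ws. length ws = m \<and> set ws = \<sigma>"
proof -
  obtain xs where xs: "set xs = \<sigma>" "distinct xs" using finite_distinct_list[OF assms(1)] by blast
  obtain x where "x \<in> \<sigma>" using assms(2) by blast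
  then have "set (xs @ replicate (m - card \<sigma>) x) = \<sigma>" using xs by auto
  moreover have "length (xs @ replicate (m - card \<sigma>) x) = m"
    using xs assms(3) distinct_card[OF xs(2)] by simp
  ultimately show ?thesis by blast
qed

text \<open>Each vertex of \<open>X\<close> or \<open>Y\<close> gets one copy, together with a
  partner chosen in \<open>C\<close>. Both projections are then defined on all of \<open>Z\<close>,
  and their values are always related by \<open>C\<close>.\<close>

lemma common_cover:
  fixes X :: "'a::linorder set" and Y :: "'b::linorder set"
  assumes fin: "finite X" "finite Y" and C: "correspondence X Y C"
  obtains Z :: "nat set" and e p e' p' where "relabelling X Z e p" "relabelling Y Z e' p'"
    "p ` Z \<subseteq> X" "p' ` Z \<subseteq> Y" "\<And>z. z \<in> Z \<Longrightarrow> (p z, p' z) \<in> C"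
proof -
  have CXY: "C \<subseteq> X \<times> Y" using C by (simp add: correspondence_def)
  have "\<forall>x\<in>X. \<exists>y. (x, y) \<in> C" "\<forall>y\<in>Y. \<exists>x. (x, y) \<in> C"
    using C by (force simp: correspondence_def)+
  then obtain \<phi> \<psi> where \<phi>: "\<And>x. x \<in> X \<Longrightarrow> (x, \<phi> x) \<in> C" and \<psi>: "\<And>y. y \<in> Y \<Longrightarrow> (\<psi> y, y) \<in> C"
    by metis
  obtain e :: "'a \<Rightarrow> nat" where e: "\<And>x y. x \<in> X \<Longrightarrow> y \<in> X \<Longrightarrow> x < y \<Longrightarrow> e x < e y"
      "\<And>x. x \<in> X \<Longrightarrow> e x < card X" using ex_rank_embedding[OF fin(1)] by blast
  obtain e0 :: "'b \<Rightarrow> nat" where e0: "\<And>x y. x \<in> Y \<Longrightarrow> y \<in> Y \<Longrightarrow> x < y \<Longrightarrow> e0 x < e0 y"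
    using ex_rank_embedding[OF fin(2)] by blast
  \<comment> \<open>The shift by \<open>card X\<close> separates the two copies and keeps
    \<open>e'\<close> increasing.\<close>
  define e' where "e' y = card X + e0 y" for y
  have inj: "inj_on e X" "inj_on e' Y"
  proof -
    have "x = y" if "x \<in> X" "y \<in> X" "e x = e y" for x y
      using that e(1)[of x y] e(1)[of y x] by (cases x y rule: linorder_cases) simp_all
    then show "inj_on e X" by (rule inj_onI)
    have "x = y" if "x \<in> Y" "y \<in> Y" "e' x = e' y" for x y
      using that e0[of x y] e0[of y x] by (cases x y rule: linorder_cases) (simp_all add: e'_def)
    then show "inj_on e' Y" by (rule inj_onI)
  qed
  have disj: "e x \<noteq> e' y" if "x \<in> X" for x y using e(2)[OF that] by (simp add: e'_def)
  define Z where "Z = e ` X \<union> e' ` Y"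
  define p where "p z = (if z \<in> e ` X then inv_into X e z else \<psi> (inv_into Y e' z))" for z
  define p' where "p' z = (if z \<in> e' ` Y then inv_into Y e' z else \<phi> (inv_into X e z))" for z
  have pe: "p (e x) = x" "p' (e x) = \<phi> x" if "x \<in> X" for x
  proof -
    have "e x \<notin> e' ` Y" using disj[OF that] by blast
    then show "p (e x) = x" "p' (e x) = \<phi> x" using that inj(1) by (simp_all add: p_def p'_def)
  qed
  have pe': "p (e' y) = \<psi> y" "p' (e' y) = y" if "y \<in> Y" for y
  proof -
    have "e' y \<notin> e ` X" using disj by (metis imageE)
    then show "p (e' y) = \<psi> y" "p' (e' y) = y" using that inj(2) by (simp_all add: p_def p'_def)
  qed
  have inC: "(p z, p' z) \<in> C" if "z \<in> Z" for z
    using that \<phi> \<psi> by (auto simp: Z_def pe pe')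
  show thesis
  proof (rule that[of Z e p e' p'])
    show "relabelling X Z e p"
      by unfold_locales (use fin e pe in \<open>auto simp: Z_def\<close>)
    show "relabelling Y Z e' p'"
      by unfold_locales (use fin e0 pe' in \<open>auto simp: Z_def e'_def\<close>)
    show "p ` Z \<subseteq> X" "p' ` Z \<subseteq> Y" using inC CXY by auto
  qed (rule inC)
qed

theorem theorem2:
  fixes K k k' :: nat
    and X :: "'a::linorder set" and Y :: "'b::linorder set"
    and rX :: "nat \<Rightarrow> 'a list \<Rightarrow> real" and rY :: "nat \<Rightarrow> 'b list \<Rightarrow> real"
  assumes "1 \<le> K"
    and "finite X" and "X \<noteq> {}" and "finite Y" and "Y \<noteq> {}"
    and "dissim_network K X rX" and "dissim_network K Y rY"
    and "1 \<le> k" and "k \<le> K" and "k' < k"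
  shows "bottleneck (pers_diag TYPE('f::field) K X rX k') (pers_diag TYPE('f) K Y rY k')
           \<le> net_dist X rX Y rY k"
proof -
  obtain C where C: "correspondence X Y C" and \<delta>: "net_dist X rX Y rY k = Gamma rX rY k C"
    using net_dist_attained[OF assms(2,4,3,5)] by blast
  obtain Z e p e' p' where Z: "relabelling X Z e p" "relabelling Y Z e' p'"
    "p ` Z \<subseteq> X" "p' ` Z \<subseteq> Y" and inC: "\<And>z. z \<in> (Z :: nat set) \<Longrightarrow> (p z, p' z) \<in> C"
    using common_cover[OF assms(2,4) C] by blast
  interpret X: network_cover X Z e p K rX
    using Z assms by (simp add: network_cover_def finite_dissim_network_def network_cover_axioms_def)
  interpret Y: network_cover Y Z e' p' K rY
    using Z assms by (simp add: network_cover_def finite_dissim_network_def network_cover_axioms_def)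
  interpret R: rank_function "rel_simplices Z k'" "pers_betti TYPE('f) Z k'"
    by (rule rank_function_pers_betti[OF X.finZ])
  have k': "k' < K" using assms by simp
  have "C \<subseteq> X \<times> Y" "fst ` C = X" using C by (simp_all add: correspondence_def)
  then have finC: "finite C" and neC: "C \<noteq> {}"
    using finite_subset[of C "X \<times> Y"] assms(2-5) by auto
  \<comment> \<open>A constant tuple at one pair of \<open>C\<close> bounds the maximum below by an
    absolute value.\<close>
  then obtain c where "c \<in> C" by blast
  then have "\<bar>rX k (map fst (replicate (Suc k) c)) - rY k (map snd (replicate (Suc k) c))\<bar> \<le> Gamma rX rY k C"
    by (intro Gamma_ge[OF finC]) auto
  then have \<delta>0: "0 \<le> Gamma rX rY k C" by linarith
  have near: "\<bar>set_val rX (p ` \<sigma>) - set_val rY (p' ` \<sigma>)\<bar> \<le> Gamma rX rY k C"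
    if \<sigma>: "\<sigma> \<in> rel_simplices Z k'" for \<sigma>
  proof -
    \<comment> \<open>Here \<open>k' < k\<close> enters: a relevant simplex has at most
      \<open>k' + 2 \<le> k + 1\<close> vertices.\<close>
    have "\<sigma> \<subseteq> Z" "card \<sigma> \<le> Suc k" "\<sigma> \<noteq> {}" using \<sigma> assms(10) by (auto simp: rel_simplices_def)
    moreover from this(1) have "finite \<sigma>" by (rule finite_subset[OF _ X.finZ])
    ultimately obtain ws where ws: "length ws = Suc k" "set ws = \<sigma>" using ex_list_of_length by metis
    define zs where "zs = map (\<lambda>w. (p w, p' w)) ws"
    have maps: "map fst zs = map p ws" "map snd zs = map p' ws" by (simp_all add: zs_def)
    have "\<bar>rX k (map fst zs) - rY k (map snd zs)\<bar> \<le> Gamma rX rY k C"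
      by (rule Gamma_ge[OF finC]) (use ws inC \<open>\<sigma> \<subseteq> Z\<close> in \<open>auto simp: zs_def\<close>)
    \<comment> \<open>\<open>r_eq_set_val\<close> absorbs both the repetitions in \<open>ws\<close>
      and distinct vertices with the same image.\<close>
    moreover have "rX k (map p ws) = set_val rX (p ` \<sigma>)"
      using X.r_eq_set_val[of k "map p ws"] ws assms(9) X.p_simplex(1)[OF \<sigma> k'] by simp
    moreover have "rY k (map p' ws) = set_val rY (p' ` \<sigma>)"
      using Y.r_eq_set_val[of k "map p' ws"] ws assms(9) Y.p_simplex(1)[OF \<sigma> k'] by simp
    ultimately show ?thesis by (simp add: maps)
  qed
  have "matched (Gamma rX rY k C) (pers_diag TYPE('f) K X rX k') (pers_diag TYPE('f) K Y rY k')"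
    by (rule R.stability[OF _ _ \<delta>0 near X.is_diag_pers_diag[OF k'] Y.is_diag_pers_diag[OF k']])
      (use X.p_simplex[OF _ k'] Y.p_simplex[OF _ k'] X.set_val_bounds Y.set_val_bounds in auto)
  then show ?thesis unfolding \<delta>
  proof (rule bottleneck_le[OF _ \<delta>0])
    show "fst q < snd q" if "q \<in># pers_diag TYPE('f) K X rX k'" for q
      using that X.count_pers_diag[of "TYPE('f)" k' "fst q" "snd q"]
      by (simp flip: count_greater_zero_iff split: if_splits)
    show "fst q < snd q" if "q \<in># pers_diag TYPE('f) K Y rY k'" for q
      using that Y.count_pers_diag[of "TYPE('f)" k' "fst q" "snd q"]
      by (simp flip: count_greater_zero_iff split: if_splits)
  qed
qed

end
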